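(* Let $n \geq 2$. On $S^{n-1} \times S^{n-1}$ there exists a positive measure $\nu_n$ such that, for all smooth functions $f,g$ on $S^{n-1}$, $$ \mathrm{cov}_{\sigma_{n-1}}(f,g) = \int_{S^{n-1}}\int_{S^{n-1}} \langle \nabla_S f(x),\nabla_S g(y)\rangle \, d\nu_n(x,y). $$ Moreover, $\nu_n = c_n \mu_n$ for a probability measure $\mu_n$ on $S^{n-1} \times S^{n-1}$ with marginals $\sigma_{n-1}$ and with a constant $c_n$ satisfying $$ \frac{1}{n-1} < c_n < \frac{1}{n-2} \quad (n \geq 3). $$
   Context: $\mathbb{R}^n$ carries the Euclidean norm $|\cdot|$ and inner product $\langle\cdot,\cdot\rangle$; $S^{n-1} = \{x \in \mathbb{R}^n : |x|=1\}$, and $\sigma_{n-1}$ is the uniform probability measure on $S^{n-1}$. The covariance is $\mathrm{cov}_{\sigma_{n-1}}(f,g) = \int fg\,d\sigma_{n-1} - \int f\,d\sigma_{n-1}\int g\,d\sigma_{n-1}$. "Smooth" means real-valued and $C^1$-smooth. The spherical gradient $\nabla_S f(x) \in \mathbb{R}^n$ at $x \in S^{n-1}$ is the shortest vector $w \in \mathbb{R}^n$ satisfying $f(x') = f(x) + \langle w, x'-x\rangle + o(|x'-x|)$ as $x' \to x$, $x' \in S^{n-1}$; it is orthogonal to $x$. Saying that $\mu_n$ has marginals $\sigma_{n-1}$ means that both of its marginals equal $\sigma_{n-1}$. *)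

theory Defs
  imports "HOL-Probability.Probability"
begin

text \<open>The uniform probability measure on the unit sphere, obtained as the normalised cone measure:
  the mass of \<open>A\<close> is the relative volume in the unit ball of the cone \<open>{x. x / norm x \<in> A}\<close>.
  That \<open>sgn 0 = 0\<close> lies off the sphere is immaterial, as the origin is a null set.\<close>

definition sphere_unif :: "'a::euclidean_space measure" where
  "sphere_unif =
     restrict_space (distr (uniform_measure lborel (ball 0 1)) borel sgn) (sphere 0 1)"

definition cov :: "'a measure \<Rightarrow> ('a \<Rightarrow> real) \<Rightarrow> ('a \<Rightarrow> real) \<Rightarrow> real" where
  "cov M f g = (\<integral>x. f x * g x \<partial>M) - (\<integral>x. f x \<partial>M) * (\<integral>x. g x \<partial>M)"

text \<open>Functions on the sphere are represented by functions on the whole space whose values off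
  the sphere play no role.  As usual for submanifolds, such a function is \<open>C\<^sup>1\<close> iff locally it is
  the restriction of a \<open>C\<^sup>1\<close> function (with gradient \<open>G\<close>) on an open subset of the ambient space.\<close>

definition C1_on_sphere :: "('a::euclidean_space \<Rightarrow> real) \<Rightarrow> bool" where
  "C1_on_sphere f \<longleftrightarrow>
     (\<forall>x \<in> sphere 0 1. \<exists>U F G. open U \<and> x \<in> U \<and>
        (\<forall>y \<in> U. (F has_derivative (\<lambda>h. G y \<bullet> h)) (at y)) \<and> continuous_on U G \<and>
        (\<forall>y \<in> U \<inter> sphere 0 1. F y = f y))"

definition sphere_grad :: "('a::euclidean_space \<Rightarrow> real) \<Rightarrow> 'a \<Rightarrow> 'a" where
  "sphere_grad f x =
     (ARG_MIN norm w. (f has_derivative (\<lambda>h. w \<bullet> h)) (at x within sphere 0 1))"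

lemma space_sphere_unif [simp]: "space (sphere_unif :: 'a::euclidean_space measure) = sphere 0 1"
  by (simp add: sphere_unif_def space_restrict_space)

lemma sets_sphere_unif [measurable_cong]:
  "sets (sphere_unif :: 'a::euclidean_space measure) = sets (restrict_space borel (sphere 0 1))"
  by (simp add: sphere_unif_def sets_restrict_space)

lemma emeasure_sphere_unif:
  fixes A :: "'a::euclidean_space set"
  assumes "A \<in> sets borel" "A \<subseteq> sphere 0 1"
  shows "emeasure sphere_unif A
    = emeasure lborel (ball 0 1 \<inter> sgn -` A) / emeasure lborel (ball 0 1 :: 'a set)"
proof -
  have [measurable]: "(sgn :: 'a \<Rightarrow> 'a) \<in> borel_measurable borel"
    unfolding sgn_div_norm by measurable
  have "sgn -` A \<in> sets borel"
    using measurable_sets_borel[of sgn borel A] assms by simp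
  then show ?thesis
    using assms unfolding sphere_unif_def
    by (subst emeasure_restrict_space)
       (auto simp: emeasure_distr emeasure_uniform_measure)
qed

lemma prob_space_sphere_unif: "prob_space (sphere_unif :: 'a::euclidean_space measure)"
proof
  let ?B = "ball 0 1 :: 'a set"
  have "?B \<inter> sgn -` sphere 0 1 = ?B - {0}"
    by (auto simp: norm_sgn)
  moreover have "emeasure lborel (?B - {0}) = emeasure lborel ?B"
    by (rule emeasure_Diff_null_set) (auto simp: null_sets_def)
  moreover have "emeasure lborel ?B \<noteq> 0"
    using unit_ball_vol_pos[of "real DIM('a)"] by (simp add: emeasure_ball del: unit_ball_vol_pos)
  moreover have "emeasure lborel ?B \<noteq> \<infinity>"
    using emeasure_lborel_ball_finite[of "0::'a" 1] by simp
  ultimately show "emeasure (sphere_unif :: 'a measure) (space sphere_unif) = 1"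
    by (simp add: emeasure_sphere_unif ennreal_divide_self top.not_eq_extremum)
qed


lemma lborel_distr_orthogonal:
  fixes T :: "'a::euclidean_space \<Rightarrow> 'a"
  assumes T: "orthogonal_transformation T"
  shows "distr lborel borel T = lborel"
proof (rule measure_eqI)
  have lin: "linear T" and nT: "\<And>x. norm (T x) = norm x"
    using T by (auto simp: orthogonal_transformation)
  have "surj T"
    by (rule orthogonal_transformation_surj[OF T])
  then obtain S where S: "\<And>x. T (S x) = x"
    by (metis surj_def)
  have [measurable]: "T \<in> borel_measurable borel"
    by (intro borel_measurable_continuous_onI linear_continuous_on)
       (simp add: lin linear_linear)
  have shift: "(\<integral>\<^sup>+x. f (c + x) \<partial>lborel) = (\<integral>\<^sup>+x. f x \<partial>lborel)"
    if [measurable]: "f \<in> borel_measurable borel" for f :: "'a \<Rightarrow> ennreal" and c :: 'a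
  proof -
    have "(\<integral>\<^sup>+x. f x \<partial>lborel) = (\<integral>\<^sup>+x. f x \<partial>distr lborel borel ((+) c))"
      by (simp add: lborel_distr_plus)
    also have "\<dots> = (\<integral>\<^sup>+x. f (c + x) \<partial>lborel)"
      by (subst nn_integral_distr) auto
    finally show ?thesis ..
  qed
  fix B assume "B \<in> sets (distr lborel borel T)"
  then have [measurable]: "B \<in> sets borel" by simp
  let ?A = "ball 0 1 :: 'a set"
  have [measurable]: "?A \<in> sets borel" by simp
  let ?a = "indicator ?A :: 'a \<Rightarrow> ennreal" and ?b = "indicator B :: 'a \<Rightarrow> ennreal"
  have "emeasure lborel ?A * emeasure (distr lborel borel T) B
      = (\<integral>\<^sup>+x. ?a x * (\<integral>\<^sup>+y. ?b (T y) \<partial>lborel) \<partial>lborel)"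
  proof -
    have "emeasure (distr lborel borel T) B = (\<integral>\<^sup>+y. ?b y \<partial>distr lborel borel T)"
      by simp
    also have "\<dots> = (\<integral>\<^sup>+y. ?b (T y) \<partial>lborel)"
      by (rule nn_integral_distr) measurable
    finally have "emeasure (distr lborel borel T) B = (\<integral>\<^sup>+y. ?b (T y) \<partial>lborel)" .
    moreover have "?a \<in> borel_measurable lborel"
      by measurable
    ultimately show ?thesis
      by (simp add: nn_integral_multc)
  qed
  also have "\<dots> = (\<integral>\<^sup>+x. (\<integral>\<^sup>+y. ?a x * ?b (x + T y) \<partial>lborel) \<partial>lborel)"
  proof (rule nn_integral_cong)
    fix x
    have "(\<integral>\<^sup>+y. ?b (T y) \<partial>lborel) = (\<integral>\<^sup>+y. ?b (T (S x + y)) \<partial>lborel)"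
      by (rule shift[symmetric]) measurable
    also have "\<dots> = (\<integral>\<^sup>+y. ?b (x + T y) \<partial>lborel)"
      by (simp add: linear_add[OF lin] S)
    finally show "?a x * (\<integral>\<^sup>+y. ?b (T y) \<partial>lborel) = (\<integral>\<^sup>+y. ?a x * ?b (x + T y) \<partial>lborel)"
      by (simp add: nn_integral_cmult)
  qed
  also have "\<dots> = (\<integral>\<^sup>+y. (\<integral>\<^sup>+x. ?a x * ?b (x + T y) \<partial>lborel) \<partial>lborel)"
    by (rule lborel_pair.Fubini'[symmetric]) measurable
  also have "\<dots> = (\<integral>\<^sup>+y. (\<integral>\<^sup>+x. ?a (x - T y) * ?b x \<partial>lborel) \<partial>lborel)"
  proof (rule nn_integral_cong)
    fix y
    have "(\<integral>\<^sup>+x. ?a (x - T y) * ?b x \<partial>lborel)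
        = (\<integral>\<^sup>+x. ?a ((T y + x) - T y) * ?b (T y + x) \<partial>lborel)"
      by (rule shift[symmetric]) measurable
    then show "(\<integral>\<^sup>+x. ?a x * ?b (x + T y) \<partial>lborel) = (\<integral>\<^sup>+x. ?a (x - T y) * ?b x \<partial>lborel)"
      by (simp add: add.commute)
  qed
  also have "\<dots> = (\<integral>\<^sup>+x. (\<integral>\<^sup>+y. ?a (x - T y) * ?b x \<partial>lborel) \<partial>lborel)"
    by (rule lborel_pair.Fubini') measurable
  also have "\<dots> = (\<integral>\<^sup>+x. emeasure lborel ?A * ?b x \<partial>lborel)"
  proof (rule nn_integral_cong)
    fix x
    have "?a (x - T (S x + y)) = ?a y" for y
      by (auto simp: indicator_def linear_add[OF lin] S nT)
    moreover have "(\<integral>\<^sup>+y. ?a (x - T y) \<partial>lborel) = (\<integral>\<^sup>+y. ?a (x - T (S x + y)) \<partial>lborel)"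
      by (rule shift[symmetric]) measurable
    ultimately show "(\<integral>\<^sup>+y. ?a (x - T y) * ?b x \<partial>lborel) = emeasure lborel ?A * ?b x"
      by (simp add: nn_integral_multc)
  qed
  also have "\<dots> = emeasure lborel ?A * emeasure lborel B"
    by (simp add: nn_integral_cmult)
  finally show "emeasure (distr lborel borel T) B = emeasure lborel B"
    using unit_ball_vol_pos[of "real DIM('a)"]
    by (auto simp: ennreal_mult_cancel_left emeasure_ball simp del: unit_ball_vol_pos)
qed simp

lemma sphere_unif_orthogonal_invariant:
  fixes T :: "'a::euclidean_space \<Rightarrow> 'a"
  assumes T: "orthogonal_transformation T" and A: "A \<in> sets borel" "A \<subseteq> sphere 0 1"
  shows "emeasure sphere_unif (T -` A) = emeasure sphere_unif A"
proof -
  let ?B = "ball 0 1 :: 'a set"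
  have lin: "linear T" and nT: "\<And>x. norm (T x) = norm x"
    using T by (auto simp: orthogonal_transformation)
  have meas [measurable]: "T \<in> borel_measurable borel"
    by (intro borel_measurable_continuous_onI linear_continuous_on)
       (simp add: lin linear_linear)
  have "(sgn :: 'a \<Rightarrow> 'a) \<in> borel_measurable borel"
    unfolding sgn_div_norm by measurable
  then have C: "?B \<inter> sgn -` A \<in> sets borel"
    using measurable_sets_borel[of sgn borel A] A by simp
  have "?B \<inter> sgn -` (T -` A) = T -` (?B \<inter> sgn -` A)"
    by (auto simp: sgn_div_norm nT linear_scale[OF lin])
  then have "emeasure lborel (?B \<inter> sgn -` (T -` A)) = emeasure (distr lborel borel T) (?B \<inter> sgn -` A)"
    using C by (simp add: emeasure_distr)
  moreover have "T -` A \<in> sets borel"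
    using measurable_sets_borel[OF meas, of A] A by simp
  moreover have "T -` A \<subseteq> sphere 0 1"
    using A nT by auto
  ultimately show ?thesis
    using A by (simp add: emeasure_sphere_unif lborel_distr_orthogonal[OF T])
qed

lemma has_derivative_sphere_radial:
  fixes x :: "'a::euclidean_space"
  assumes x: "norm x = 1"
  shows "((\<lambda>y. 0::real) has_derivative (\<lambda>h. (c *\<^sub>R x) \<bullet> h)) (at x within sphere 0 1)"
proof -
  have eq: "(c *\<^sub>R x) \<bullet> (y - x) = - (c / 2) * (norm (y - x))\<^sup>2" if "y \<in> sphere 0 1" for y
  proof -
    have "x \<bullet> x = 1" "y \<bullet> y = 1" using x that by (auto simp: norm_eq_1)
    then show ?thesis
      by (simp add: power2_norm_eq_inner inner_diff inner_commute algebra_simps)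
  qed
  have "((\<lambda>y. (\<bar>c\<bar> / 2) * norm (y - x)) \<longlongrightarrow> (\<bar>c\<bar> / 2) * norm (x - x)) (at x within sphere 0 1)"
    by (intro tendsto_intros)
  then have lim: "((\<lambda>y. (\<bar>c\<bar> / 2) * norm (y - x)) \<longlongrightarrow> 0) (at x within sphere 0 1)"
    by simp
  have "((\<lambda>y. norm (0 - 0 - (c *\<^sub>R x) \<bullet> (y - x)) / norm (y - x)) \<longlongrightarrow> 0) (at x within sphere 0 1)"
    by (rule Lim_transform_eventually[OF lim])
       (auto simp: eventually_at_filter eq abs_mult power2_eq_square simp del: inner_scaleR_left)
  then show ?thesis
    by (simp only: has_derivative_iff_norm bounded_linear_inner_right simp_thms)
qed

lemma sphere_grad_eqI:
  fixes x :: "'a::euclidean_space"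
  assumes x: "norm x = 1"
    and w: "(f has_derivative (\<lambda>h. w \<bullet> h)) (at x within sphere 0 1)" and orth: "w \<bullet> x = 0"
  shows "sphere_grad f x = w"
proof -
  let ?P = "\<lambda>w. (f has_derivative (\<lambda>h. w \<bullet> h)) (at x within sphere 0 1)"
  have tangent: "u \<bullet> v = w \<bullet> v" if u: "?P u" and v: "v \<bullet> x = 0" "norm v = 1" for u v
  proof -
    define \<gamma> where "\<gamma> t = cos t *\<^sub>R x + sin t *\<^sub>R v" for t
    have "\<gamma> t \<bullet> \<gamma> t = 1" for t
    proof -
      have "x \<bullet> x = 1" "v \<bullet> v = 1" using x v by (auto simp: norm_eq_1)
      then have "\<gamma> t \<bullet> \<gamma> t = (cos t)\<^sup>2 + (sin t)\<^sup>2"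
        using v by (simp add: \<gamma>_def inner_add inner_commute power2_eq_square)
      then show ?thesis by simp
    qed
    then have im: "\<gamma> ` UNIV \<subseteq> sphere 0 1" by (auto simp: norm_eq_1)
    have d: "(\<gamma> has_derivative (\<lambda>t. t *\<^sub>R v)) (at 0)"
      unfolding \<gamma>_def by (auto intro!: derivative_eq_intros)
    have "((f \<circ> \<gamma>) has_derivative ((\<lambda>h. u \<bullet> h) \<circ> (\<lambda>t. t *\<^sub>R v))) (at 0)" if "?P u" for u
      by (rule diff_chain_within)
         (use d that im in \<open>auto simp: \<gamma>_def intro: has_derivative_subset\<close>)
    from has_derivative_unique[OF this[OF u] this[OF w]] show ?thesis
      by (metis comp_apply scaleR_one)
  qed
  have decomp: "\<exists>c. u = w + c *\<^sub>R x" if u: "?P u" for u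
  proof -
    let ?v = "(u - w) - ((u - w) \<bullet> x) *\<^sub>R x"
    have xx: "x \<bullet> x = 1" using x by (simp add: norm_eq_1)
    have vx: "?v \<bullet> x = 0" by (simp add: inner_diff_left xx)
    have "?v = 0"
    proof (rule ccontr)
      assume nz: "?v \<noteq> 0"
      have "u \<bullet> sgn ?v = w \<bullet> sgn ?v"
        by (rule tangent[OF u]) (use nz vx in \<open>auto simp: sgn_div_norm norm_sgn\<close>)
      then have "(u - w) \<bullet> ?v = 0"
        using nz by (simp add: sgn_div_norm inner_diff_left)
      moreover have "?v \<bullet> ?v = (u - w) \<bullet> ?v - ((u - w) \<bullet> x) * (?v \<bullet> x)"
        by (metis inner_commute inner_diff_left inner_scaleR_left)
      ultimately have "?v \<bullet> ?v = 0" using vx by simp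
      with nz show False by simp
    qed
    then have "u = w + ((u - w) \<bullet> x) *\<^sub>R x"
      by (simp add: algebra_simps)
    then show ?thesis by blast
  qed
  have less: "norm w < norm u" if u: "?P u" and ne: "u \<noteq> w" for u
  proof -
    obtain c where c: "u = w + c *\<^sub>R x" using decomp[OF u] by blast
    have "c \<noteq> 0" using c ne by auto
    moreover have "(norm u)\<^sup>2 = (norm w)\<^sup>2 + c\<^sup>2"
      using x orth unfolding c
      by (simp add: power2_norm_eq_inner inner_add_left inner_add_right inner_commute norm_eq_1)
        (simp add: inner_commute power2_eq_square)
    ultimately have "(norm w)\<^sup>2 < (norm u)\<^sup>2" by simp
    then show ?thesis by (rule power_less_imp_less_base) simp
  qed
  have "is_arg_min norm ?P w"
    unfolding is_arg_min_def using w less by (metis less_asym)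
  then have "is_arg_min norm ?P (sphere_grad f x)"
    unfolding sphere_grad_def arg_min_def by (rule someI)
  then show ?thesis
    using less w unfolding is_arg_min_def by blast
qed

lemma
  fixes x :: "'a::euclidean_space"
  assumes x: "norm x = 1" and u: "(f has_derivative (\<lambda>h. u \<bullet> h)) (at x within sphere 0 1)"
  shows has_derivative_sphere_grad:
      "(f has_derivative (\<lambda>h. sphere_grad f x \<bullet> h)) (at x within sphere 0 1)"
    and sphere_grad_orthogonal: "sphere_grad f x \<bullet> x = 0"
    and sphere_grad_eq_projection: "sphere_grad f x = u - (u \<bullet> x) *\<^sub>R x"
proof -
  let ?w = "u - (u \<bullet> x) *\<^sub>R x"
  have w: "(f has_derivative (\<lambda>h. ?w \<bullet> h)) (at x within sphere 0 1)"
    using has_derivative_diff[OF u has_derivative_sphere_radial[OF x, of "u \<bullet> x"]]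
    by (simp add: inner_diff_left)
  have orth: "?w \<bullet> x = 0"
    using x by (simp add: inner_diff_left norm_eq_1)
  show *: "sphere_grad f x = ?w"
    by (rule sphere_grad_eqI[OF x w orth])
  show "(f has_derivative (\<lambda>h. sphere_grad f x \<bullet> h)) (at x within sphere 0 1)"
    unfolding * by (rule w)
  show "sphere_grad f x \<bullet> x = 0"
    unfolding * by (rule orth)
qed

end

theory Submission
  imports Defs
begin

text \<open>
  The representation descends from the Gaussian one.  Let \<open>X\<close> and \<open>Z\<close> be independent standard
  Gaussian vectors and extend \<open>f\<close>, \<open>g\<close> to functions \<open>F\<close>, \<open>G\<close> that are constant along rays.  The
  direction of \<open>X\<close> is uniform on the sphere, so \<open>cov f g = E F(X) (G(X) - G(Z))\<close>.  Turn \<open>X\<close> into \<open>Z\<close>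
  along \<open>Y(\<theta>) = cos \<theta> X + sin \<theta> Z\<close>, \<open>0 \<le> \<theta> \<le> \<pi>/2\<close>.  With \<open>W(\<theta>) = sin \<theta> X - cos \<theta> Z = - Y'(\<theta>)\<close>,
  the fundamental theorem of calculus gives
  \<open>G(X) - G(Z) = \<integral> \<langle>\<nabla>G(Y(\<theta>)), W(\<theta>)\<rangle> d\<theta>\<close>.
  The map \<open>(X, Z) \<mapsto> (Y(\<theta>), W(\<theta>))\<close> is an orthogonal involution of the doubled space.  Hence
  \<open>(Y, W)\<close> is again a pair of independent Gaussians and \<open>X = cos \<theta> Y + sin \<theta> W\<close>.  Gaussian
  integration by parts in \<open>W\<close> with \<open>Y\<close> held fixed turns the factor \<open>W\<close> into \<open>sin \<theta> \<nabla>F(X)\<close>: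
  \<open>cov f g = \<integral> sin \<theta> E \<langle>\<nabla>F(cos \<theta> Y + sin \<theta> W), \<nabla>G(Y)\<rangle> d\<theta>\<close>.

  Since \<open>\<nabla>F(x)\<close> is the spherical gradient of \<open>f\<close> at the direction of \<open>x\<close> divided by \<open>norm x\<close>, the
  right-hand side is an integral against the law of the two directions weighted by
  \<open>sin \<theta> / (norm X * norm Y)\<close>.  This is the measure \<open>cov_measure\<close>, and the identity is
  \<open>covariance_representation\<close>.  Dimension at least two enters twice: \<open>1 / norm x\<close> is
  then Gaussian integrable, so the measure is finite, and a line is a null set, so that almost every
  line and almost every rotating path avoids the singularity of \<open>F\<close> and \<open>G\<close> at the origin.

  The weight depends on \<open>Y\<close> only through its norm once \<open>W\<close> is integrated out, so by polar coordinates
  the second marginal is a multiple of the uniform measure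
  (\<open>emeasure_cov_measure_snd\<close>); the involution exchanges the two marginals.

  The bounds on the total mass \<open>c\<close> are read off from the representation itself.  Taking for \<open>f = g\<close>
  the coordinate functions and summing over an orthonormal basis gives
  \<open>1 = (n - 2) c + \<integral> (x \<bullet> y)\<^sup>2\<close> (\<open>cov_measure_trace_identity\<close>).  Almost everywhere
  \<open>0 < (x \<bullet> y)\<^sup>2 < 1\<close>, so the last integral lies strictly between \<open>0\<close> and \<open>c\<close>, which is equivalent
  to the two strict bounds when \<open>n \<ge> 3\<close>.
\<close>

section \<open>Polar coordinates\<close>

text \<open>The value at \<open>0\<close> is an arbitrary unit vector, so that \<open>direction\<close> maps the whole space measurably into
  the sphere and can be used to push measures forward to it, unlike \<open>sgn\<close>.\<close>

definition direction :: "'a::euclidean_space \<Rightarrow> 'a" where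
  "direction x = (if x = 0 then SOME b. b \<in> Basis else sgn x)"

lemma norm_direction [simp]: "norm (direction x) = 1"
  by (auto simp: direction_def norm_sgn some_in_eq)

lemma direction_scaleR_norm: "norm x *\<^sub>R direction x = x"
  by (auto simp: direction_def sgn_div_norm)

lemma direction_eq_divideR: "x \<noteq> 0 \<Longrightarrow> direction x = x /\<^sub>R norm x"
  by (simp add: direction_def sgn_div_norm)

lemma direction_borel_measurable [measurable]: "direction \<in> borel_measurable borel"
proof -
  have [measurable]: "(sgn :: 'a \<Rightarrow> 'a) \<in> borel_measurable borel"
    unfolding sgn_div_norm by measurable
  show ?thesis unfolding direction_def[abs_def] by measurable
qed

lemma direction_measurable [measurable]: "direction \<in> borel \<rightarrow>\<^sub>M sphere_unif"
proof -
  have "direction \<in> borel \<rightarrow>\<^sub>M restrict_space borel (sphere 0 1)"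
    by (rule measurable_restrict_space2) auto
  then show ?thesis by (simp cong: measurable_cong_sets add: sets_sphere_unif)
qed

lemma lborel_scale_emeasure:
  fixes A :: "'a::euclidean_space set"
  assumes "r > 0" and [measurable]: "A \<in> sets borel"
  shows "emeasure lborel A = ennreal (r ^ DIM('a)) * emeasure lborel ((\<lambda>x. r *\<^sub>R x) -` A)"
proof -
  have "emeasure lborel A = emeasure (density (distr lborel borel (\<lambda>x. r *\<^sub>R x)) (\<lambda>_. \<bar>r\<bar>^DIM('a))) A"
    using lborel_affine[of r "0::'a"] assms by simp
  also have "\<dots> = ennreal (r ^ DIM('a)) * emeasure (distr lborel borel (\<lambda>x::'a. r *\<^sub>R x)) A"
    using assms(1) by (simp add: emeasure_density nn_integral_cmult_indicator)
  also have "\<dots> = ennreal (r ^ DIM('a)) * emeasure lborel ((\<lambda>x. r *\<^sub>R x) -` A)"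
    by (simp add: emeasure_distr)
  finally show ?thesis .
qed

text \<open>The law of the norm under Lebesgue measure: its mass below \<open>R\<close> is the volume of the ball of radius \<open>R\<close>.\<close>

definition radial_measure :: "'a::euclidean_space itself \<Rightarrow> real measure" where
  "radial_measure _ = density lborel
     (\<lambda>r. ennreal (measure lborel (ball 0 1 :: 'a set) * (real DIM('a) * r ^ (DIM('a) - 1))) * indicator {0..} r)"

lemma sets_radial_measure [measurable_cong, simp]: "sets (radial_measure TYPE('a::euclidean_space)) = sets borel"
  by (simp add: radial_measure_def)

lemma emeasure_radial_measure_lessThan:
  assumes "R \<ge> 0"
  shows "emeasure (radial_measure TYPE('a::euclidean_space)) {..<R} = ennreal (measure lborel (ball 0 1 :: 'a set) * R ^ DIM('a))"
proof -
  let ?w = "measure lborel (ball 0 1 :: 'a set)"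
  have "emeasure (radial_measure TYPE('a)) {..<R}
      = (\<integral>\<^sup>+r. ennreal (?w * (real DIM('a) * r ^ (DIM('a) - 1))) * indicator {0..R} r \<partial>lborel)"
    unfolding radial_measure_def
  proof (subst emeasure_density, measurable, rule nn_integral_cong_AE)
    have "AE r in lborel. r \<noteq> R"
      by (rule AE_lborel_singleton)
    then show "AE r in lborel. ennreal (?w * (real DIM('a) * r ^ (DIM('a) - 1))) * indicator {0..} r * indicator {..<R} r
      = ennreal (?w * (real DIM('a) * r ^ (DIM('a) - 1))) * indicator {0..R} r"
      by eventually_elim (auto simp: indicator_def)
  qed
  also have "\<dots> = ennreal (?w * R ^ DIM('a) - ?w * 0 ^ DIM('a))"
    by (rule nn_integral_FTC_Icc) (use assms in \<open>auto intro!: derivative_eq_intros mult_nonneg_nonneg\<close>)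
  finally show ?thesis by (simp add: zero_power DIM_positive)
qed

lemma sigma_finite_radial_measure: "sigma_finite_measure (radial_measure TYPE('a::euclidean_space))"
proof
  have "(\<Union>i. {..<real i}) = UNIV"
    using reals_Archimedean2 by auto
  moreover have "space (radial_measure TYPE('a)) = UNIV"
    by (simp add: radial_measure_def)
  ultimately show "\<exists>A. countable A \<and> A \<subseteq> sets (radial_measure TYPE('a)) \<and> \<Union>A = space (radial_measure TYPE('a))
     \<and> (\<forall>a\<in>A. emeasure (radial_measure TYPE('a)) a \<noteq> \<infinity>)"
    by (intro exI[of _ "range (\<lambda>i. {..<real i})"]) (auto simp: emeasure_radial_measure_lessThan)
qed

text \<open>By dilation invariance, the part of the cone over \<open>A\<close> in the ball of radius \<open>R\<close> has
  \<open>R ^ DIM('a)\<close> times the volume of its part in the unit ball, which the definition of \<open>sphere_unif\<close> expresses through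
  the mass of \<open>A\<close>.  So for fixed \<open>A\<close> both sides, as measures in \<open>B\<close>, agree on the intervals \<open>{..<R}\<close>, which
  determine them.\<close>

lemma polar_coordinates_emeasure:
  fixes A :: "'a::euclidean_space set"
  assumes A: "A \<in> sets sphere_unif" and B [measurable]: "B \<in> sets borel"
  shows "emeasure lborel {x. direction x \<in> A \<and> norm x \<in> B}
    = emeasure sphere_unif A * emeasure (radial_measure TYPE('a)) B"
proof -
  let ?w = "measure lborel (ball 0 1 :: 'a set)"
  let ?C = "direction -` A"
  have [measurable]: "A \<in> sets borel" and Asub: "A \<subseteq> sphere 0 1"
    using A by (auto simp: sets_sphere_unif sets_restrict_space)
  have [measurable]: "?C \<in> sets borel"
    using measurable_sets_borel[of direction borel A] by simp
  define M1 where "M1 = distr (density lborel (indicator ?C)) borel norm"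
  define M2 where "M2 = density (radial_measure TYPE('a)) (\<lambda>_. emeasure sphere_unif A)"
  interpret S: prob_space "sphere_unif :: 'a measure" by (rule prob_space_sphere_unif)
  have wpos: "?w > 0"
    by (simp add: content_ball)
  have wfin: "emeasure lborel (ball 0 1 :: 'a set) = ennreal ?w"
    using emeasure_lborel_ball_finite[of "0::'a" 1] by (simp add: emeasure_eq_ennreal_measure)
  have unit: "emeasure lborel (ball 0 1 \<inter> ?C) = emeasure sphere_unif A * ennreal ?w"
  proof -
    have [measurable]: "(sgn :: 'a \<Rightarrow> 'a) \<in> borel_measurable borel"
      unfolding sgn_div_norm by measurable
    have "sgn -` A \<in> sets borel"
      using measurable_sets_borel[of sgn borel A] by simp
    moreover have "AE x in lborel. x \<noteq> (0::'a)" by (rule AE_lborel_singleton)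
    \<comment> \<open>\<open>direction\<close> and \<open>sgn\<close> differ at the origin only, a null set.\<close>
    then have "AE x in lborel. (x \<in> ball 0 1 \<inter> ?C) = (x \<in> ball 0 1 \<inter> sgn -` A)"
      by eventually_elim (simp add: direction_def)
    ultimately have "emeasure lborel (ball 0 1 \<inter> ?C) = emeasure lborel (ball 0 1 \<inter> sgn -` A)"
      by (auto intro!: emeasure_eq_AE)
    then show ?thesis
      using wpos wfin Asub by (simp add: emeasure_sphere_unif ennreal_divide_times)
  qed
  have eq: "emeasure M1 {..<R} = emeasure M2 {..<R}" for R
  proof -
    have l: "emeasure M1 {..<R} = emeasure lborel (?C \<inter> {x. norm x < R})"
      unfolding M1_def by (subst emeasure_distr) (auto simp: emeasure_density indicator_inter_arith[symmetric] vimage_def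
        intro!: arg_cong[where f="emeasure lborel"])
    have r: "emeasure M2 {..<R} = emeasure sphere_unif A * emeasure (radial_measure TYPE('a)) {..<R}"
      unfolding M2_def by (simp add: emeasure_density nn_integral_cmult_indicator)
    consider "R > 0" | "R \<le> 0" by linarith
    then show ?thesis
    proof cases
      case 1
      have "emeasure lborel (?C \<inter> {x. norm x < R})
          = ennreal (R ^ DIM('a)) * emeasure lborel ((\<lambda>x. R *\<^sub>R x) -` (?C \<inter> {x. norm x < R}))"
        by (rule lborel_scale_emeasure[OF 1]) measurable
      also have "(\<lambda>x. R *\<^sub>R x) -` (?C \<inter> {x. norm x < R}) = ball 0 1 \<inter> ?C"
        using 1 by (auto simp: direction_def sgn_scaleR)
      finally show ?thesis
        using 1 by (simp add: l r unit emeasure_radial_measure_lessThan ennreal_mult ac_simps)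
    next
      case 2
      have "emeasure (radial_measure TYPE('a)) {..<R} \<le> emeasure (radial_measure TYPE('a)) {..<0}"
        using 2 by (intro emeasure_mono) auto
      then have "emeasure (radial_measure TYPE('a)) {..<R} = 0"
        by (simp add: emeasure_radial_measure_lessThan zero_power DIM_positive)
      moreover have "?C \<inter> {x. norm x < R} = {}"
        using 2 by (auto dest: order_less_le_trans)
      ultimately show ?thesis by (simp add: l r)
    qed
  qed
  have "M1 = M2"
  proof (rule measure_eqI_generator_eq[where \<Omega>=UNIV and E="range lessThan" and A="\<lambda>i. {..<real i}"])
    show "Int_stable (range (lessThan :: real \<Rightarrow> _))"
    proof -
      have "{..<a} \<inter> {..<b} = {..<min a b}" for a b :: real by auto
      then show ?thesis by (auto simp: Int_stable_def)
    qed
    show "(\<Union>i. {..<real i}) = UNIV"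
      using reals_Archimedean2 by auto
    show "emeasure M1 {..<real i} \<noteq> \<infinity>" for i
      unfolding eq unfolding M2_def
      by (simp add: emeasure_density nn_integral_cmult_indicator emeasure_radial_measure_lessThan ennreal_mult_eq_top_iff)
  qed (auto simp: eq, auto simp: M1_def M2_def borel_Iio)
  then have "emeasure M1 B = emeasure M2 B" by simp
  moreover have "emeasure M1 B = emeasure lborel {x. direction x \<in> A \<and> norm x \<in> B}"
  proof -
    have [measurable]: "norm -` B \<in> sets (borel :: 'a measure)"
      using measurable_sets_borel[of norm borel B] by simp
    have "emeasure M1 B = emeasure lborel (?C \<inter> norm -` B)"
      unfolding M1_def by (subst emeasure_distr)
        (auto simp: emeasure_density indicator_inter_arith[symmetric])
    also have "?C \<inter> norm -` B = {x. direction x \<in> A \<and> norm x \<in> B}" by auto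
    finally show ?thesis .
  qed
  moreover have "emeasure M2 B = emeasure sphere_unif A * emeasure (radial_measure TYPE('a)) B"
    unfolding M2_def by (simp add: emeasure_density nn_integral_cmult_indicator)
  ultimately show ?thesis by simp
qed

lemma polar_coordinates:
  "distr lborel (sphere_unif \<Otimes>\<^sub>M borel) (\<lambda>x::'a::euclidean_space. (direction x, norm x))
    = sphere_unif \<Otimes>\<^sub>M radial_measure TYPE('a)"
proof (rule sym, rule pair_measure_eqI)
  show "sigma_finite_measure (sphere_unif :: 'a measure)"
    by (intro prob_space_imp_sigma_finite prob_space_sphere_unif)
  show "sigma_finite_measure (radial_measure TYPE('a))"
    by (rule sigma_finite_radial_measure)
  fix A :: "'a set" and B assume "A \<in> sets sphere_unif" "B \<in> sets (radial_measure TYPE('a))"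
  then show "emeasure sphere_unif A * emeasure (radial_measure TYPE('a)) B
     = emeasure (distr lborel (sphere_unif \<Otimes>\<^sub>M borel) (\<lambda>x::'a. (direction x, norm x))) (A \<times> B)"
    by (subst emeasure_distr)
       (auto simp: polar_coordinates_emeasure[symmetric] intro!: arg_cong[where f="emeasure lborel"])
qed (auto intro!: sets_pair_measure_cong)

text \<open>Under Lebesgue measure direction and norm are independent; since this measure is infinite, the independence
  has to be stated as a factorisation of integrals.\<close>

lemma nn_integral_polar:
  fixes h :: "'a::euclidean_space \<Rightarrow> ennreal" and q :: "real \<Rightarrow> ennreal"
  assumes [measurable]: "h \<in> borel_measurable sphere_unif" "q \<in> borel_measurable borel"
  shows "(\<integral>\<^sup>+x. h (direction x) * q (norm x) \<partial>lborel)
    = (\<integral>\<^sup>+x. h x \<partial>sphere_unif) * (\<integral>\<^sup>+r. q r \<partial>radial_measure TYPE('a))"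
proof -
  interpret S: prob_space "sphere_unif :: 'a measure" by (rule prob_space_sphere_unif)
  have "(\<integral>\<^sup>+x. h (direction x) * q (norm x) \<partial>lborel)
     = (\<integral>\<^sup>+z. h (fst z) * q (snd z) \<partial>distr lborel (sphere_unif \<Otimes>\<^sub>M borel) (\<lambda>x::'a. (direction x, norm x)))"
    by (subst nn_integral_distr) auto
  also have "\<dots> = (\<integral>\<^sup>+z. h (fst z) * q (snd z) \<partial>(sphere_unif \<Otimes>\<^sub>M radial_measure TYPE('a)))"
    by (simp add: polar_coordinates)
  also have "\<dots> = (\<integral>\<^sup>+x. h x \<partial>sphere_unif) * (\<integral>\<^sup>+r. q r \<partial>radial_measure TYPE('a))"
  proof -
    interpret R: sigma_finite_measure "radial_measure TYPE('a)" by (rule sigma_finite_radial_measure)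
    show ?thesis
      by (subst R.nn_integral_fst[symmetric]) (auto simp: nn_integral_cmult nn_integral_multc)
  qed
  finally show ?thesis .
qed

lemma nn_integral_radial:
  fixes q :: "real \<Rightarrow> ennreal"
  assumes [measurable]: "q \<in> borel_measurable borel"
  shows "(\<integral>\<^sup>+x. q (norm (x::'a::euclidean_space)) \<partial>lborel) = (\<integral>\<^sup>+r. q r \<partial>radial_measure TYPE('a))"
  using nn_integral_polar[of "\<lambda>_::'a. 1" q] prob_space.emeasure_space_1[OF prob_space_sphere_unif[where 'a='a]]
  by simp

section \<open>The standard Gaussian measure\<close>

lemma nn_integral_radial_measure:
  assumes [measurable]: "q \<in> borel_measurable borel"
  shows "(\<integral>\<^sup>+r. q r \<partial>radial_measure TYPE('a::euclidean_space))
    = (\<integral>\<^sup>+r. ennreal (measure lborel (ball 0 1 :: 'a set) * (real DIM('a) * r ^ (DIM('a) - 1))) * indicator {0..} r * q r \<partial>lborel)"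
  unfolding radial_measure_def by (subst nn_integral_density) auto

text \<open>Up to a constant these are the absolute moments of the one-dimensional normal distribution.\<close>

lemma half_gaussian_moment_finite:
  "(\<integral>\<^sup>+r. ennreal (r ^ k * exp (- r\<^sup>2 / 2)) * indicator {0..} r \<partial>lborel) < \<infinity>"
proof -
  have "integrable lborel (\<lambda>r. sqrt (2 * pi) * (std_normal_density r * \<bar>r\<bar> ^ k))"
    by (intro integrable_mult_right integrable_std_normal_moment_abs)
  then have "(\<integral>\<^sup>+r. ennreal (norm (sqrt (2 * pi) * (std_normal_density r * \<bar>r\<bar> ^ k))) \<partial>lborel) < \<infinity>"
    by (simp only: integrable_iff_bounded)
  moreover have "(\<integral>\<^sup>+r. ennreal (r ^ k * exp (- r\<^sup>2 / 2)) * indicator {0..} r \<partial>lborel)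
     \<le> (\<integral>\<^sup>+r. ennreal (norm (sqrt (2 * pi) * (std_normal_density r * \<bar>r\<bar> ^ k))) \<partial>lborel)"
    by (rule nn_integral_mono) (auto simp: std_normal_density_def abs_mult indicator_def)
  ultimately show ?thesis by (rule order_le_less_trans[rotated])
qed

lemma nn_integral_norm_power_gaussian_finite:
  "(\<integral>\<^sup>+x. ennreal (norm x ^ k * exp (- (norm x)\<^sup>2 / 2)) \<partial>(lborel :: 'a::euclidean_space measure)) < \<infinity>"
proof -
  let ?w = "measure lborel (ball 0 1 :: 'a set)" and ?n = "DIM('a)"
  have "(\<integral>\<^sup>+x. ennreal (norm x ^ k * exp (- (norm x)\<^sup>2 / 2)) \<partial>(lborel :: 'a measure))
    = (\<integral>\<^sup>+r. ennreal (?w * real ?n) * (ennreal (r ^ (?n - 1 + k) * exp (- r\<^sup>2 / 2)) * indicator {0..} r) \<partial>lborel)"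
    by (subst nn_integral_radial, measurable, subst nn_integral_radial_measure, measurable)
       (auto intro!: nn_integral_cong simp: power_add[symmetric] indicator_def ennreal_mult[symmetric] ac_simps)
  also have "\<dots> < \<infinity>"
    using half_gaussian_moment_finite[of "?n - 1 + k"]
    by (subst nn_integral_cmult) (auto simp: ennreal_mult_less_top)
  finally show ?thesis .
qed

text \<open>In polar coordinates the integrand \<open>1 / r\<close> is absorbed by the Jacobian \<open>r ^ (DIM('a) - 1)\<close>; this is where
  dimension one fails.\<close>

lemma nn_integral_inverse_norm_ball_finite:
  assumes "DIM('a::euclidean_space) \<ge> 2"
  shows "(\<integral>\<^sup>+x. ennreal (1 / norm x) * indicator {0..1} (norm x) \<partial>(lborel :: 'a measure)) < \<infinity>"
proof -
  let ?w = "measure lborel (ball 0 1 :: 'a set)" and ?n = "DIM('a)"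
  have "(\<integral>\<^sup>+x. ennreal (1 / norm x) * indicator {0..1} (norm x) \<partial>(lborel :: 'a measure))
    = (\<integral>\<^sup>+r. ennreal (?w * (real ?n * r ^ (?n - 1))) * indicator {0..} r * (ennreal (1 / r) * indicator {0..1} r) \<partial>lborel)"
    using nn_integral_radial[where 'a='a, of "\<lambda>r. ennreal (1 / r) * indicator {0..1} r"]
    by (simp add: nn_integral_radial_measure)
  also have "\<dots> \<le> (\<integral>\<^sup>+r. ennreal (?w * real ?n) * indicator {0..1} (r::real) \<partial>lborel)"
  proof (rule nn_integral_mono, goal_cases)
    case (1 r)
    have "r ^ (?n - 1) * (1 / r) \<le> 1" if "0 \<le> r" "r \<le> 1"
    proof (cases "r = 0")
      case False
      have "r ^ (?n - 1) = r * r ^ (?n - 2)"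
        using assms by (metis Suc_1 Suc_diff_Suc Suc_le_eq diff_Suc_1 power_Suc plus_1_eq_Suc le_add_diff_inverse diff_Suc_Suc)
      then show ?thesis using False that by (simp add: power_le_one)
    qed simp
    then have "?w * (real ?n * r ^ (?n - 1)) * (1 / r) \<le> ?w * real ?n * 1" if "0 \<le> r" "r \<le> 1"
      using that by (metis (no_types, lifting) measure_nonneg mult.assoc mult_left_mono mult_nonneg_nonneg of_nat_0_le_iff)
    then show ?case
      by (auto simp: indicator_def ennreal_mult[symmetric] intro!: ennreal_leI simp del: times_divide_eq_right)
  qed
  also have "\<dots> < \<infinity>"
    by (simp add: nn_integral_cmult_indicator ennreal_mult_less_top)
  finally show ?thesis .
qed

text \<open>The value of this integral, \<open>(2 * pi) powr (DIM('a) / 2)\<close>, is immaterial: only its positivity matters.\<close>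

definition gauss_norm :: "'a::euclidean_space itself \<Rightarrow> real" where
  "gauss_norm _ = (\<integral>x. exp (- (norm x)\<^sup>2 / 2) \<partial>(lborel :: 'a measure))"

definition gauss_density :: "'a::euclidean_space \<Rightarrow> real" where
  "gauss_density x = exp (- (norm x)\<^sup>2 / 2) / gauss_norm TYPE('a)"

definition gauss :: "'a::euclidean_space measure" where
  "gauss = density lborel (\<lambda>x. ennreal (gauss_density x))"

lemma integrable_gaussian: "integrable lborel (\<lambda>x::'a::euclidean_space. exp (- (norm x)\<^sup>2 / 2))"
  by (rule integrableI_bounded) (use nn_integral_norm_power_gaussian_finite[of 0, where 'a='a] in auto)

lemma gauss_norm_pos: "gauss_norm TYPE('a::euclidean_space) > 0"
proof -
  let ?f = "\<lambda>x::'a. exp (- (norm x)\<^sup>2 / 2)"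
  have "gauss_norm TYPE('a) \<noteq> 0"
  proof
    assume "gauss_norm TYPE('a) = 0"
    then have "AE x in lborel. ?f x = 0"
      using integral_nonneg_eq_0_iff_AE[OF integrable_gaussian[where 'a='a]] by (simp add: gauss_norm_def)
    then show False
      by (simp add: AE_iff_measurable[OF _ refl])
  qed
  then show ?thesis
    by (simp add: gauss_norm_def order_less_le)
qed

lemma gauss_density_pos [simp]: "gauss_density x > 0"
  by (simp add: gauss_density_def gauss_norm_pos)

lemma gauss_density_nonneg [simp]: "gauss_density x \<ge> 0"
  by (simp add: less_imp_le)

lemma gauss_density_le: "gauss_density (x::'a::euclidean_space) \<le> 1 / gauss_norm TYPE('a)"
  using gauss_norm_pos[where 'a='a] by (simp add: gauss_density_def field_simps)

lemma gauss_density_measurable [measurable]: "gauss_density \<in> borel_measurable borel"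
  unfolding gauss_density_def[abs_def] by measurable

lemma sets_gauss [simp, measurable_cong]: "sets gauss = sets borel"
  by (simp add: gauss_def)

lemma space_gauss [simp]: "space gauss = UNIV"
  by (simp add: gauss_def)

lemma prob_space_gauss: "prob_space gauss"
proof
  have "emeasure gauss (space (gauss :: 'a measure)) = (\<integral>\<^sup>+x. ennreal (gauss_density (x::'a)) \<partial>lborel)"
    by (simp add: gauss_def emeasure_density)
  also have "\<dots> = ennreal (\<integral>x. gauss_density (x::'a) \<partial>lborel)"
    by (rule nn_integral_eq_integral) (use integrable_gaussian in \<open>auto simp: gauss_density_def[abs_def] gauss_norm_pos less_imp_le\<close>)
  also have "(\<integral>x. gauss_density (x::'a) \<partial>lborel) = 1"
    using gauss_norm_pos[where 'a='a] by (simp add: gauss_density_def gauss_norm_def)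
  finally show "emeasure gauss (space (gauss :: 'a measure)) = 1" by simp
qed

interpretation gauss: prob_space "gauss :: 'a::euclidean_space measure"
  by (rule prob_space_gauss)

interpretation gauss_pair: pair_prob_space "gauss :: 'a::euclidean_space measure" "gauss :: 'b::euclidean_space measure" ..

lemma nn_integral_gauss:
  assumes [measurable]: "f \<in> borel_measurable borel"
  shows "(\<integral>\<^sup>+x. f x \<partial>gauss) = (\<integral>\<^sup>+x. ennreal (gauss_density x) * f x \<partial>lborel)"
  unfolding gauss_def by (subst nn_integral_density) auto

lemma AE_gauss: "AE x in lborel. P x \<Longrightarrow> AE x in gauss. P x"
  unfolding gauss_def by (subst AE_density) (auto elim: eventually_mono)

text \<open>Direction and norm of a Gaussian vector are independent, and the direction is uniform.\<close>

lemma nn_integral_gauss_direction: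
  fixes h :: "'a::euclidean_space \<Rightarrow> ennreal"
  assumes [measurable]: "h \<in> borel_measurable sphere_unif" "q \<in> borel_measurable borel"
  shows "(\<integral>\<^sup>+x. h (direction x) * q (norm x) \<partial>gauss) = (\<integral>\<^sup>+x. h x \<partial>sphere_unif) * (\<integral>\<^sup>+x. q (norm (x::'a)) \<partial>gauss)"
proof -
  let ?q = "\<lambda>r. ennreal (exp (- r\<^sup>2 / 2) / gauss_norm TYPE('a)) * q r"
  have 1: "(\<integral>\<^sup>+x. q (norm (x::'a)) \<partial>gauss) = (\<integral>\<^sup>+r. ?q r \<partial>radial_measure TYPE('a))"
    by (subst nn_integral_gauss, measurable, subst nn_integral_radial[symmetric], measurable) (simp add: gauss_density_def)
  have "(\<integral>\<^sup>+x. h (direction x) * q (norm x) \<partial>gauss) = (\<integral>\<^sup>+x. h (direction x) * ?q (norm x) \<partial>lborel)"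
    by (subst nn_integral_gauss, measurable) (simp add: gauss_density_def ac_simps)
  also have "\<dots> = (\<integral>\<^sup>+x. h x \<partial>sphere_unif) * (\<integral>\<^sup>+r. ?q r \<partial>radial_measure TYPE('a))"
    by (rule nn_integral_polar) measurable
  finally show ?thesis unfolding 1 .
qed

lemma distr_gauss_direction: "distr gauss sphere_unif direction = (sphere_unif :: 'a::euclidean_space measure)"
proof (rule measure_eqI)
  fix A :: "'a set" assume "A \<in> sets (distr gauss sphere_unif direction)"
  then have A [measurable]: "A \<in> sets sphere_unif" by simp
  have "emeasure (distr gauss sphere_unif direction) A = (\<integral>\<^sup>+x. indicator A x \<partial>distr gauss sphere_unif direction)"
    by simp
  also have "\<dots> = (\<integral>\<^sup>+x. indicator A (direction x) * 1 \<partial>gauss)"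
    by (subst nn_integral_distr) auto
  also have "\<dots> = emeasure sphere_unif A"
    using nn_integral_gauss_direction[of "indicator A" "\<lambda>_. 1"] gauss.emeasure_space_1[where 'a='a] by simp
  finally show "emeasure (distr gauss sphere_unif direction) A = emeasure sphere_unif A" .
qed simp

lemma pair_gauss_density:
  "(gauss :: 'a::euclidean_space measure) \<Otimes>\<^sub>M (gauss :: 'a measure)
   = density lborel (\<lambda>z. ennreal (exp (- (norm z)\<^sup>2 / 2) / (gauss_norm TYPE('a) * gauss_norm TYPE('a))))"
proof -
  interpret D: sigma_finite_measure "density lborel (\<lambda>x::'a. ennreal (gauss_density x))"
    unfolding gauss_def[symmetric] by (rule gauss.sigma_finite_measure_axioms)
  have "(gauss :: 'a measure) \<Otimes>\<^sub>M (gauss :: 'a measure)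
     = density (lborel \<Otimes>\<^sub>M lborel) (\<lambda>(x, y). ennreal (gauss_density x) * ennreal (gauss_density y))"
    unfolding gauss_def
    by (rule pair_measure_density) (auto intro: lborel.sigma_finite_measure_axioms D.sigma_finite_measure_axioms)
  also have "\<dots> = density lborel (\<lambda>z. ennreal (exp (- (norm z)\<^sup>2 / 2) / (gauss_norm TYPE('a) * gauss_norm TYPE('a))))"
  proof -
    have "(\<lambda>(x, y). ennreal (gauss_density x) * ennreal (gauss_density y))
      = (\<lambda>z::'a \<times> 'a. ennreal (exp (- (norm z)\<^sup>2 / 2) / (gauss_norm TYPE('a) * gauss_norm TYPE('a))))"
      by (auto simp: fun_eq_iff gauss_density_def norm_prod_def ennreal_mult[symmetric] mult_exp_exp
        gauss_norm_pos less_imp_le diff_divide_distrib)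
    then show ?thesis by (simp only: lborel_prod)
  qed
  finally show ?thesis .
qed

text \<open>Lebesgue measure and the norm are both invariant under orthogonal transformations.\<close>

lemma distr_radial_density_orthogonal:
  fixes T :: "'a::euclidean_space \<Rightarrow> 'a"
  assumes T: "orthogonal_transformation T" and [measurable]: "q \<in> borel_measurable borel"
  shows "distr (density lborel (\<lambda>x. q (norm x))) borel T = density lborel (\<lambda>x. q (norm x))"
proof -
  have [measurable]: "T \<in> borel_measurable borel"
    using T by (intro borel_measurable_continuous_onI linear_continuous_on)
       (simp add: linear_linear orthogonal_transformation_linear)
  have "density lborel (\<lambda>x. q (norm x)) = density (distr lborel borel T) (\<lambda>x. q (norm x))"
    by (simp add: lborel_distr_orthogonal[OF T])
  also have "\<dots> = distr (density lborel (\<lambda>x. q (norm (T x)))) borel T"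
    by (rule density_distr) measurable
  finally show ?thesis using T by (simp add: orthogonal_transformation_norm)
qed

lemma distr_gauss_orthogonal:
  fixes T :: "'a::euclidean_space \<Rightarrow> 'a"
  shows "orthogonal_transformation T \<Longrightarrow> distr gauss borel T = (gauss :: 'a::euclidean_space measure)"
  using distr_radial_density_orthogonal[of T "\<lambda>r. ennreal (exp (- r\<^sup>2 / 2) / gauss_norm TYPE('a))"]
  by (simp add: gauss_def gauss_density_def[abs_def])

text \<open>Being a radial function on the doubled space, the density of an independent pair is invariant under
  all of its orthogonal transformations, not only under those acting on each factor; in
  particular the two components may be rotated into each other.\<close>

lemma distr_pair_gauss_orthogonal:
  fixes T :: "'a::euclidean_space \<times> 'a \<Rightarrow> 'a \<times> 'a"
  shows "orthogonal_transformation T \<Longrightarrow> distr (gauss \<Otimes>\<^sub>M gauss) borel T = (gauss \<Otimes>\<^sub>M gauss :: ('a::euclidean_space \<times> 'a) measure)"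
  using distr_radial_density_orthogonal[of T "\<lambda>r. ennreal (exp (- r\<^sup>2 / 2) / (gauss_norm TYPE('a) * gauss_norm TYPE('a)))"]
  by (simp add: pair_gauss_density)

lemma integrable_gauss_norm: "integrable gauss (\<lambda>x::'a::euclidean_space. norm x)"
proof (rule integrableI_bounded)
  have "(\<integral>\<^sup>+x. ennreal (norm (norm (x::'a))) \<partial>gauss)
     = (\<integral>\<^sup>+x. ennreal (1 / gauss_norm TYPE('a)) * ennreal (norm x ^ 1 * exp (- (norm x)\<^sup>2 / 2)) \<partial>(lborel :: 'a measure))"
    by (subst nn_integral_gauss) (auto intro!: nn_integral_cong simp: gauss_density_def ennreal_mult[symmetric]
       gauss_norm_pos less_imp_le)
  also have "\<dots> < \<infinity>"
    using nn_integral_norm_power_gaussian_finite[of 1, where 'a='a]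
    by (subst nn_integral_cmult) (auto simp: ennreal_mult_less_top)
  finally show "(\<integral>\<^sup>+x. ennreal (norm (norm (x::'a))) \<partial>gauss) < \<infinity>" .
qed simp

text \<open>The Gaussian density is bounded and \<open>1 / norm x \<le> 1\<close> off the unit ball, so the integral
  of \<open>1 / norm x\<close> over the unit ball controls every translate \<open>1 / norm (a + w)\<close> by the same
  constant; the factor \<open>1 / s\<close> comes from rescaling.\<close>

lemma nn_integral_gauss_inverse_norm_bound:
  assumes "DIM('a::euclidean_space) \<ge> 2"
  obtains K where "K \<ge> 0"
    "\<And>a s. s > 0 \<Longrightarrow> (\<integral>\<^sup>+w. ennreal (1 / norm (a + s *\<^sub>R w)) \<partial>(gauss :: 'a measure)) \<le> ennreal (K / s)"
proof -
  define I where "I = (\<integral>\<^sup>+x. ennreal (1 / norm x) * indicator {0..1} (norm x) \<partial>(lborel :: 'a measure))"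
  define Z where "Z = gauss_norm TYPE('a)"
  have Z: "Z > 0" unfolding Z_def by (rule gauss_norm_pos)
  have Ifin: "I < \<infinity>" unfolding I_def by (rule nn_integral_inverse_norm_ball_finite[OF assms])
  define K where "K = 1 + 1 / Z * enn2real I"
  have base: "(\<integral>\<^sup>+w. ennreal (1 / norm (a + w)) \<partial>(gauss :: 'a measure)) \<le> ennreal K" for a :: 'a
  proof -
    let ?J = "\<lambda>x::'a. ennreal (1 / norm x) * indicator {0..1} (norm x)"
    have "(\<integral>\<^sup>+w. ennreal (1 / norm (a + w)) \<partial>(gauss :: 'a measure)) \<le> (\<integral>\<^sup>+w. 1 + ?J (a + w) \<partial>gauss)"
    proof (rule nn_integral_mono)
      fix w show "ennreal (1 / norm (a + w)) \<le> 1 + ?J (a + w)"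
        by (cases "norm (a + w) \<le> 1") (auto simp: indicator_def ennreal_le_1 divide_simps intro: order_trans)
    qed
    also have "\<dots> = 1 + (\<integral>\<^sup>+w. ?J (a + w) \<partial>gauss)"
      using gauss.emeasure_space_1 by (subst nn_integral_add) auto
    also have "(\<integral>\<^sup>+w. ?J (a + w) \<partial>gauss) = (\<integral>\<^sup>+w. ennreal (gauss_density w) * ?J (a + w) \<partial>lborel)"
      by (rule nn_integral_gauss) measurable
    also have "\<dots> \<le> (\<integral>\<^sup>+w. ennreal (1 / Z) * ?J (a + w) \<partial>lborel)"
      unfolding Z_def by (intro nn_integral_mono mult_right_mono ennreal_leI gauss_density_le) auto
    also have "\<dots> = ennreal (1 / Z) * (\<integral>\<^sup>+w. ?J (a + w) \<partial>lborel)"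
      by (rule nn_integral_cmult) measurable
    also have "(\<integral>\<^sup>+w. ?J (a + w) \<partial>lborel) = (\<integral>\<^sup>+w. ?J w \<partial>distr lborel borel ((+) a))"
      by (subst nn_integral_distr) auto
    also have "\<dots> = I" by (simp add: lborel_distr_plus I_def)
    also have "1 + ennreal (1 / Z) * I = ennreal K"
      using Ifin Z by (cases I) (auto simp: K_def ennreal_mult[symmetric] simp flip: ennreal_1 ennreal_plus)
    finally show ?thesis by (simp add: add_left_mono)
  qed
  show ?thesis
  proof (rule that[of K])
    show "K \<ge> 0" using Z by (simp add: K_def)
    fix a :: 'a and s :: real assume s: "s > 0"
    have "(\<integral>\<^sup>+w. ennreal (1 / norm (a + s *\<^sub>R w)) \<partial>gauss) = (\<integral>\<^sup>+w. ennreal (1 / s) * ennreal (1 / norm ((1/s) *\<^sub>R a + w)) \<partial>gauss)"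
    proof (rule nn_integral_cong)
      fix w
      have "a + s *\<^sub>R w = s *\<^sub>R ((1/s) *\<^sub>R a + w)" using s by (simp add: scaleR_add_right)
      then have "norm (a + s *\<^sub>R w) = s * norm ((1/s) *\<^sub>R a + w)" using s by (metis abs_of_pos norm_scaleR)
      then show "ennreal (1 / norm (a + s *\<^sub>R w)) = ennreal (1 / s) * ennreal (1 / norm ((1/s) *\<^sub>R a + w))"
        using s by (simp add: ennreal_mult[symmetric] del: scaleR_add_right)
    qed
    also have "\<dots> = ennreal (1 / s) * (\<integral>\<^sup>+w. ennreal (1 / norm ((1/s) *\<^sub>R a + w)) \<partial>gauss)"
      by (rule nn_integral_cmult) measurable
    also have "\<dots> \<le> ennreal (1 / s) * ennreal K" by (intro mult_left_mono base) auto
    also have "\<dots> = ennreal (K / s)" using s \<open>K \<ge> 0\<close> by (simp add: ennreal_mult[symmetric])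
    finally show "(\<integral>\<^sup>+w. ennreal (1 / norm (a + s *\<^sub>R w)) \<partial>(gauss :: 'a measure)) \<le> ennreal (K / s)" .
  qed
qed

section \<open>Homogeneous extension of functions on the sphere\<close>

text \<open>The gradient of the extension \<open>f \<circ> direction\<close>, which is constant along rays (see \<open>has_derivative_homog\<close>).\<close>

definition homog_grad :: "('a::euclidean_space \<Rightarrow> real) \<Rightarrow> 'a \<Rightarrow> 'a" where
  "homog_grad f x = sphere_grad f (direction x) /\<^sub>R norm x"

lemma has_derivative_direction:
  fixes x :: "'a::euclidean_space"
  assumes "x \<noteq> 0"
  shows "(direction has_derivative (\<lambda>h. (h - (direction x \<bullet> h) *\<^sub>R direction x) /\<^sub>R norm x)) (at x)"
proof -
  have "((\<lambda>y. y /\<^sub>R norm y) has_derivative (\<lambda>h. (h - (direction x \<bullet> h) *\<^sub>R direction x) /\<^sub>R norm x)) (at x)"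
    using assms
    by (auto intro!: derivative_eq_intros has_derivative_norm simp: fun_eq_iff direction_eq_divideR inner_commute sgn_div_norm
        algebra_simps)
  moreover have "open (- {0::'a})" "x \<in> - {0}" using assms by auto
  ultimately show ?thesis
    by (rule has_derivative_transform_within_open) (auto simp: direction_eq_divideR)
qed

lemma C1_on_sphere_local:
  fixes x :: "'a::euclidean_space"
  assumes f: "C1_on_sphere f" and x: "norm x = 1"
  obtains U F G where "open U" "x \<in> U" "\<And>y. y \<in> U \<Longrightarrow> (F has_derivative (\<lambda>h. G y \<bullet> h)) (at y)"
    "continuous_on U G" "\<And>y. y \<in> U \<Longrightarrow> norm y = 1 \<Longrightarrow> F y = f y"
    "\<And>y. y \<in> U \<Longrightarrow> norm y = 1 \<Longrightarrow> sphere_grad f y = G y - (G y \<bullet> y) *\<^sub>R y"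
proof -
  obtain U F G where U: "open U" "x \<in> U" and F: "\<And>y. y \<in> U \<Longrightarrow> (F has_derivative (\<lambda>h. G y \<bullet> h)) (at y)"
    and G: "continuous_on U G" and eq: "\<And>y. y \<in> U \<Longrightarrow> norm y = 1 \<Longrightarrow> F y = f y"
    using f x unfolding C1_on_sphere_def by (metis IntI mem_sphere_0)
  have "sphere_grad f y = G y - (G y \<bullet> y) *\<^sub>R y" if y: "y \<in> U" "norm y = 1" for y
  proof (rule sphere_grad_eq_projection[OF y(2)])
    have "(F has_derivative (\<lambda>h. G y \<bullet> h)) (at y within sphere 0 1)"
      using F[OF y(1)] by (rule has_derivative_at_withinI)
    then show "(f has_derivative (\<lambda>h. G y \<bullet> h)) (at y within sphere 0 1)"
    proof (rule has_derivative_transform_eventually)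
      show "\<forall>\<^sub>F z in at y within sphere 0 1. F z = f z"
        using U(1) y(1) eq by (auto simp: eventually_at_topological)
    qed (use y eq in auto)
  qed
  with U F G eq show ?thesis using that by blast
qed

lemma continuous_on_sphere_grad:
  assumes f: "C1_on_sphere (f :: 'a::euclidean_space \<Rightarrow> real)"
  shows "continuous_on (sphere 0 1) (sphere_grad f)"
  unfolding continuous_on_eq_continuous_within
proof
  fix x :: 'a assume "x \<in> sphere 0 1"
  then have x: "norm x = 1" by simp
  obtain U F G where U: "open U" "x \<in> U" and G: "continuous_on U G"
    and sg: "\<And>y. y \<in> U \<Longrightarrow> norm y = 1 \<Longrightarrow> sphere_grad f y = G y - (G y \<bullet> y) *\<^sub>R y"
    using C1_on_sphere_local[OF f x] by metis
  have "isCont G x" using G U by (simp add: continuous_on_eq_continuous_at)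
  then have "isCont (\<lambda>y. G y - (G y \<bullet> y) *\<^sub>R y) x" by (intro continuous_intros)
  then have "continuous (at x within sphere 0 1) (\<lambda>y. G y - (G y \<bullet> y) *\<^sub>R y)"
    by (rule continuous_at_imp_continuous_at_within)
  then have "((\<lambda>y. G y - (G y \<bullet> y) *\<^sub>R y) \<longlongrightarrow> sphere_grad f x) (at x within sphere 0 1)"
    using sg[OF U(2) x] by (simp add: continuous_within)
  then show "continuous (at x within sphere 0 1) (sphere_grad f)"
    unfolding continuous_within
  proof (rule Lim_transform_eventually)
    show "\<forall>\<^sub>F y in at x within sphere 0 1. G y - (G y \<bullet> y) *\<^sub>R y = sphere_grad f y"
      using U sg by (auto simp: eventually_at_topological)
  qed
qed

lemma continuous_on_C1_on_sphere:
  assumes f: "C1_on_sphere (f :: 'a::euclidean_space \<Rightarrow> real)"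
  shows "continuous_on (sphere 0 1) f"
  unfolding continuous_on_eq_continuous_within
proof
  fix x :: 'a assume "x \<in> sphere 0 1"
  then have x: "norm x = 1" by simp
  obtain U F G where U: "open U" "x \<in> U" and F: "\<And>y. y \<in> U \<Longrightarrow> (F has_derivative (\<lambda>h. G y \<bullet> h)) (at y)"
    and eq: "\<And>y. y \<in> U \<Longrightarrow> norm y = 1 \<Longrightarrow> F y = f y"
    using C1_on_sphere_local[OF f x] by metis
  have "isCont F x" using F[OF U(2)] by (rule has_derivative_continuous)
  then have "continuous (at x within sphere 0 1) F"
    by (rule continuous_at_imp_continuous_at_within)
  then have "(F \<longlongrightarrow> f x) (at x within sphere 0 1)"
    using eq[OF U(2) x] by (simp add: continuous_within)
  then show "continuous (at x within sphere 0 1) f"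
    unfolding continuous_within
  proof (rule Lim_transform_eventually)
    show "\<forall>\<^sub>F y in at x within sphere 0 1. F y = f y"
      using U eq by (auto simp: eventually_at_topological)
  qed
qed

lemma C1_on_sphere_bounded:
  assumes f: "C1_on_sphere (f :: 'a::euclidean_space \<Rightarrow> real)"
  obtains C where "C \<ge> 0" "\<And>x. norm x = 1 \<Longrightarrow> \<bar>f x\<bar> \<le> C" "\<And>x. norm x = 1 \<Longrightarrow> norm (sphere_grad f x) \<le> C"
proof -
  have "bounded (f ` sphere 0 1)" "bounded (sphere_grad f ` sphere 0 1)"
    using continuous_on_sphere_grad[OF f] continuous_on_C1_on_sphere[OF f]
    by (auto intro!: compact_imp_bounded compact_continuous_image)
  then obtain A B where "\<forall>y\<in>f ` sphere 0 1. norm y \<le> A" "\<forall>y\<in>sphere_grad f ` sphere 0 1. norm y \<le> B"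
    unfolding bounded_iff by blast
  then have A: "\<And>x. norm x = 1 \<Longrightarrow> \<bar>f x\<bar> \<le> A" and B: "\<And>x. norm x = 1 \<Longrightarrow> norm (sphere_grad f x) \<le> B"
    by auto
  show ?thesis
    by (rule that[of "max 0 (max A B)"]) (use A B in \<open>fastforce simp: le_max_iff_disj\<close>)+
qed

lemma C1_on_sphere_measurable:
  assumes f: "C1_on_sphere (f :: 'a::euclidean_space \<Rightarrow> real)"
  shows "f \<in> borel_measurable sphere_unif" and "sphere_grad f \<in> borel_measurable sphere_unif"
  using borel_measurable_continuous_on_restrict[OF continuous_on_sphere_grad[OF f]]
    borel_measurable_continuous_on_restrict[OF continuous_on_C1_on_sphere[OF f]]
  by (simp_all cong: measurable_cong_sets add: sets_sphere_unif)

lemma homog_measurable: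
  assumes f: "C1_on_sphere (f :: 'a::euclidean_space \<Rightarrow> real)"
  shows "(\<lambda>x. f (direction x)) \<in> borel_measurable borel" and "homog_grad f \<in> borel_measurable borel"
proof -
  note [measurable] = C1_on_sphere_measurable[OF f]
  show "(\<lambda>x. f (direction x)) \<in> borel_measurable borel" by measurable
  show "homog_grad f \<in> borel_measurable borel" unfolding homog_grad_def[abs_def] by measurable
qed

text \<open>The derivative of \<open>direction\<close> at \<open>x\<close> is the projection onto the tangent space, divided by
  \<open>norm x\<close>; applied to the gradient of a local extension, the projection produces the spherical gradient.\<close>

lemma has_derivative_homog:
  assumes f: "C1_on_sphere (f :: 'a::euclidean_space \<Rightarrow> real)" and x: "x \<noteq> 0"
  shows "((\<lambda>y. f (direction y)) has_derivative (\<lambda>h. homog_grad f x \<bullet> h)) (at x)"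
proof -
  let ?u = "direction x"
  obtain U F G where U: "open U" "?u \<in> U" and F: "\<And>y. y \<in> U \<Longrightarrow> (F has_derivative (\<lambda>h. G y \<bullet> h)) (at y)"
    and eq: "\<And>y. y \<in> U \<Longrightarrow> norm y = 1 \<Longrightarrow> F y = f y"
    and sg: "\<And>y. y \<in> U \<Longrightarrow> norm y = 1 \<Longrightarrow> sphere_grad f y = G y - (G y \<bullet> y) *\<^sub>R y"
    using C1_on_sphere_local[OF f norm_direction[of x]] by metis
  note d = has_derivative_direction[OF x]
  have "((\<lambda>y. F (direction y)) has_derivative (\<lambda>h. G ?u \<bullet> ((h - (?u \<bullet> h) *\<^sub>R ?u) /\<^sub>R norm x))) (at x)"
    using has_derivative_compose[OF d F[OF U(2)]] by simp
  moreover have "(\<lambda>h. G ?u \<bullet> ((h - (?u \<bullet> h) *\<^sub>R ?u) /\<^sub>R norm x)) = (\<lambda>h. homog_grad f x \<bullet> h)"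
    by (simp add: homog_grad_def sg[OF U(2)] fun_eq_iff inner_diff_left inner_diff_right algebra_simps)
  ultimately have "((\<lambda>y. F (direction y)) has_derivative (\<lambda>h. homog_grad f x \<bullet> h)) (at x)" by simp
  moreover have "\<forall>\<^sub>F y in at x within UNIV. F (direction y) = f (direction y)"
  proof -
    have "isCont direction x" using d by (rule has_derivative_continuous)
    then have "\<forall>\<^sub>F y in at x. direction y \<in> U"
      using U by (auto simp: isCont_def dest: topological_tendstoD)
    then show ?thesis by eventually_elim (simp add: eq)
  qed
  ultimately show ?thesis
    by (rule has_derivative_transform_eventually) (use U eq in auto)
qed

lemma continuous_on_homog_grad:
  assumes f: "C1_on_sphere (f :: 'a::euclidean_space \<Rightarrow> real)"
  shows "continuous_on (- {0}) (homog_grad f)"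
proof -
  have d: "continuous_on (- {0}) (direction :: 'a \<Rightarrow> 'a)"
    by (rule has_derivative_continuous_on) (auto intro: has_derivative_at_withinI has_derivative_direction)
  have "continuous_on (- {0}) (\<lambda>x. sphere_grad f (direction x))"
    by (rule continuous_on_compose2[OF continuous_on_sphere_grad[OF f] d]) auto
  then show ?thesis
    unfolding homog_grad_def[abs_def] by (intro continuous_intros) auto
qed

lemma homog_grad_bound:
  assumes "\<And>x. norm x = 1 \<Longrightarrow> norm (sphere_grad f x) \<le> C"
  shows "norm (homog_grad f x) \<le> C * (1 / norm x)"
  using mult_left_mono[OF assms[OF norm_direction[of x]], of "inverse (norm x)"]
  by (simp add: homog_grad_def divide_inverse mult.commute)

lemma AE_lborel_closed_negligible:
  fixes S :: "'a::euclidean_space set"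
  assumes "closed S" "negligible S"
  shows "AE x in lborel. x \<notin> S"
proof -
  have "S \<in> null_sets lborel"
    using assms by (simp add: negligible_iff_null_sets null_sets_completion_iff)
  then show ?thesis by (rule AE_not_in)
qed

lemma AE_lborel_not_line:
  fixes c e :: "'a::euclidean_space"
  assumes "DIM('a) \<ge> 2"
  shows "AE x in lborel. c + x \<notin> span {e}"
proof -
  have "dim (span {e}) < DIM('a)"
    using dim_le_card[of "{e}" "{e}"] assms by (auto simp: dim_span)
  then have "negligible (span {e})" by (rule negligible_lowdim)
  then have "negligible ((+) (- c) ` span {e})" by (rule negligible_translation)
  moreover have "closed ((+) (- c) ` span {e})"
    by (intro closed_translation closed_subspace subspace_span)
  ultimately have "AE x in lborel. x \<notin> (+) (- c) ` span {e}"
    by (intro AE_lborel_closed_negligible)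
  then show ?thesis
    by eventually_elim (auto simp: image_iff)
qed

lemma AE_lborel_not_hyperplane:
  fixes b :: "'a::euclidean_space"
  assumes "b \<noteq> 0"
  shows "AE x in lborel. b \<bullet> x \<noteq> r"
  using AE_lborel_closed_negligible[OF closed_hyperplane negligible_hyperplane] assms by auto

section \<open>Gaussian integration by parts\<close>

text \<open>By translation invariance \<open>\<integral> \<Phi>(x + e) - \<Phi>(x) dx = 0\<close>.  Writing the increment as the
  integral of the derivative over the segment from \<open>x\<close> to \<open>x + e\<close> and exchanging the
  integrals, each translate of \<open>D\<close> contributes the same amount \<open>\<integral> D\<close>, which is therefore zero.  Smoothness is
  required on almost all lines parallel to \<open>e\<close> only, so an isolated singularity is allowed.\<close>

lemma integral_directional_derivative_eq_0:
  fixes \<Phi> D :: "'a::euclidean_space \<Rightarrow> real" and e :: 'a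
  assumes int: "integrable lborel \<Phi>" and intD: "integrable lborel D"
    and deriv: "AE x in lborel. (\<forall>t\<in>{0..1}. ((\<lambda>t. \<Phi> (x + t *\<^sub>R e)) has_vector_derivative D (x + t *\<^sub>R e)) (at t within {0..1}))
       \<and> continuous_on {0..1} (\<lambda>t. D (x + t *\<^sub>R e))"
  shows "(\<integral>x. D x \<partial>lborel) = 0"
proof -
  have [measurable]: "\<Phi> \<in> borel_measurable borel" "D \<in> borel_measurable borel"
    using int intD by auto
  have shift: "integrable lborel (\<lambda>x. f (x + c))" "(\<integral>x. f (x + c) \<partial>lborel) = (\<integral>x. f x \<partial>lborel)"
    if "integrable lborel f" for f :: "'a \<Rightarrow> real" and c
  proof -
    have [measurable]: "f \<in> borel_measurable borel" using that by auto
    have "integrable (distr lborel borel ((+) c)) f" using that by (simp add: lborel_distr_plus)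
    then show "integrable lborel (\<lambda>x. f (x + c))" by (subst (asm) integrable_distr_eq) (auto simp: add.commute)
    have "(\<integral>x. f x \<partial>lborel) = (\<integral>x. f x \<partial>distr lborel borel ((+) c))" by (simp add: lborel_distr_plus)
    also have "\<dots> = (\<integral>x. f (x + c) \<partial>lborel)" by (subst integral_distr) (auto simp: add.commute)
    finally show "(\<integral>x. f (x + c) \<partial>lborel) = (\<integral>x. f x \<partial>lborel)" ..
  qed
  let ?g = "\<lambda>(t::real) (x::'a). indicator {0..1} t * D (x + t *\<^sub>R e)"
  have 1: "(\<integral>t. ?g t x \<partial>lborel) = \<Phi> (x + e) - \<Phi> x"
    if "(\<forall>t\<in>{0..1}. ((\<lambda>t. \<Phi> (x + t *\<^sub>R e)) has_vector_derivative D (x + t *\<^sub>R e)) (at t within {0..1}))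
       \<and> continuous_on {0..1} (\<lambda>t. D (x + t *\<^sub>R e))" for x
    using integral_FTC_atLeastAtMost[of 0 1 "\<lambda>t. \<Phi> (x + t *\<^sub>R e)" "\<lambda>t. D (x + t *\<^sub>R e)"] that by simp
  have intg: "integrable (lborel \<Otimes>\<^sub>M lborel) (\<lambda>(t, x). ?g t x)"
  proof (rule lborel_pair.Fubini_integrable)
    have "(\<integral>x. norm (?g t x) \<partial>lborel) = indicator {0..1} t * (\<integral>x. \<bar>D x\<bar> \<partial>lborel)" for t
      using shift(2)[OF integrable_abs[OF intD], of "t *\<^sub>R e"] by (simp add: abs_mult)
    then show "integrable lborel (\<lambda>t. \<integral>x. norm (case (t, x) of (t, x) \<Rightarrow> ?g t x) \<partial>lborel)" by simp
    show "AE t in lborel. integrable lborel (\<lambda>x. case (t, x) of (t, x) \<Rightarrow> ?g t x)"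
      using shift(1)[OF intD] by (intro AE_I2) simp
  qed (simp add: borel_prod, measurable)
  have "0 = (\<integral>x. \<Phi> (x + e) \<partial>lborel) - (\<integral>x. \<Phi> x \<partial>lborel)"
    using shift(2)[OF int] by simp
  also have "\<dots> = (\<integral>x. \<Phi> (x + e) - \<Phi> x \<partial>lborel)"
    by (rule Bochner_Integration.integral_diff[symmetric]) (use int shift(1) in auto)
  also have "\<dots> = (\<integral>x. (\<integral>t. ?g t x \<partial>lborel) \<partial>lborel)"
    by (rule integral_cong_AE, measurable) (use deriv in \<open>eventually_elim; simp add: 1\<close>)
  also have "\<dots> = (\<integral>t. (\<integral>x. ?g t x \<partial>lborel) \<partial>lborel)"
    using lborel_pair.Fubini_integral[OF intg] .
  also have "\<dots> = (\<integral>t. indicator {0..1} (t::real) * (\<integral>x. D x \<partial>lborel) \<partial>lborel)"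
    by (simp add: shift(2)[OF intD])
  also have "\<dots> = (\<integral>x. D x \<partial>lborel)" by (simp add: content_real)
  finally show ?thesis ..
qed

lemma integral_gauss:
  fixes f :: "'a::euclidean_space \<Rightarrow> real"
  assumes [measurable]: "f \<in> borel_measurable borel"
  shows "(\<integral>x. f x \<partial>gauss) = (\<integral>x. gauss_density x * f x \<partial>lborel)"
  unfolding gauss_def by (subst integral_density) auto

lemma integrable_gauss_iff:
  fixes f :: "'a::euclidean_space \<Rightarrow> real"
  assumes [measurable]: "f \<in> borel_measurable borel"
  shows "integrable gauss f \<longleftrightarrow> integrable lborel (\<lambda>x. gauss_density x * f x)"
  unfolding gauss_def by (subst integrable_density) auto

lemma has_derivative_gauss_density:
  fixes x :: "'a::euclidean_space"
  shows "(gauss_density has_derivative (\<lambda>h. - gauss_density x * (x \<bullet> h))) (at x)"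
proof -
  have eq: "gauss_density = (\<lambda>x::'a. exp (- (x \<bullet> x) / 2) / gauss_norm TYPE('a))"
    by (simp add: gauss_density_def fun_eq_iff power2_norm_eq_inner)
  show ?thesis unfolding eq
    using gauss_norm_pos[where 'a='a] by (auto intro!: derivative_eq_intros simp: inner_commute fun_eq_iff)
qed

lemma integrable_homog_grad:
  assumes dim: "DIM('a::euclidean_space) \<ge> 2" and f: "C1_on_sphere (f :: 'a \<Rightarrow> real)" and s: "s > 0"
  shows "integrable gauss (\<lambda>w. homog_grad f (a + s *\<^sub>R w) \<bullet> e)"
proof -
  note [measurable] = homog_measurable[OF f]
  obtain C where C: "C \<ge> 0" "\<And>x. norm x = 1 \<Longrightarrow> norm (sphere_grad f x) \<le> C"
    using C1_on_sphere_bounded[OF f] by metis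
  obtain K where K: "\<And>a s. s > 0 \<Longrightarrow> (\<integral>\<^sup>+w. ennreal (1 / norm (a + s *\<^sub>R w)) \<partial>(gauss :: 'a measure)) \<le> ennreal (K / s)"
    using nn_integral_gauss_inverse_norm_bound[OF dim] by metis
  show ?thesis
  proof (rule integrableI_bounded)
    have "(\<integral>\<^sup>+w. ennreal (norm (homog_grad f (a + s *\<^sub>R w) \<bullet> e)) \<partial>gauss)
        \<le> (\<integral>\<^sup>+w. ennreal (C * norm e) * ennreal (1 / norm (a + s *\<^sub>R w)) \<partial>gauss)"
    proof (rule nn_integral_mono)
      fix w
      have "norm (homog_grad f (a + s *\<^sub>R w) \<bullet> e) \<le> norm (homog_grad f (a + s *\<^sub>R w)) * norm e"
        by (simp add: Cauchy_Schwarz_ineq2)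
      also have "\<dots> \<le> (C * (1 / norm (a + s *\<^sub>R w))) * norm e"
        by (intro mult_right_mono homog_grad_bound C) auto
      finally show "ennreal (norm (homog_grad f (a + s *\<^sub>R w) \<bullet> e)) \<le> ennreal (C * norm e) * ennreal (1 / norm (a + s *\<^sub>R w))"
        using C(1) by (simp add: ennreal_mult[symmetric] ennreal_leI mult.commute)
    qed
    also have "\<dots> = ennreal (C * norm e) * (\<integral>\<^sup>+w. ennreal (1 / norm (a + s *\<^sub>R w)) \<partial>gauss)"
      by (rule nn_integral_cmult) measurable
    also have "\<dots> \<le> ennreal (C * norm e) * ennreal (K / s)"
      by (intro mult_left_mono K s) auto
    also have "\<dots> < \<infinity>" by (simp add: ennreal_mult_less_top)
    finally show "(\<integral>\<^sup>+w. ennreal (norm (homog_grad f (a + s *\<^sub>R w) \<bullet> e)) \<partial>gauss) < \<infinity>" .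
  qed simp
qed

text \<open>The product of the Gaussian density and \<open>w \<mapsto> f (direction (a + s w))\<close> has, away from its singular point, the
  derivative in direction \<open>e\<close> that is called \<open>D\<close> below; its integral vanishes, which is the claim.  The only
  singular point is \<open>w = - a / s\<close>, and almost every line parallel to \<open>e\<close> misses it.\<close>

lemma gauss_integration_by_parts:
  assumes dim: "DIM('a::euclidean_space) \<ge> 2" and f: "C1_on_sphere (f :: 'a \<Rightarrow> real)" and s: "s > 0"
  shows "(\<integral>w. f (direction (a + s *\<^sub>R w)) * (e \<bullet> w) \<partial>gauss) = s * (\<integral>w. homog_grad f (a + s *\<^sub>R w) \<bullet> e \<partial>gauss)"
proof -
  note [measurable] = homog_measurable[OF f]
  obtain C where C: "C \<ge> 0" "\<And>x. norm x = 1 \<Longrightarrow> \<bar>f x\<bar> \<le> C"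
    using C1_on_sphere_bounded[OF f] by metis
  define F where "F w = f (direction (a + s *\<^sub>R w))" for w
  define H where "H w = homog_grad f (a + s *\<^sub>R w)" for w
  define D where "D w = gauss_density w * (s * (H w \<bullet> e)) - gauss_density w * (F w * (e \<bullet> w))" for w
  have [measurable]: "F \<in> borel_measurable borel" "H \<in> borel_measurable borel"
    unfolding F_def[abs_def] H_def[abs_def] by measurable
  have Fb: "\<bar>F w\<bar> \<le> C" for w by (simp add: F_def C)
  have iF: "integrable lborel (\<lambda>w. gauss_density w * F w)"
    by (subst integrable_gauss_iff[symmetric])
       (auto intro!: gauss.integrable_const_bound[where B=C] simp: Fb)
  have iH: "integrable gauss (\<lambda>w. H w \<bullet> e)"
    unfolding H_def by (rule integrable_homog_grad[OF dim f s])
  have iFw: "integrable gauss (\<lambda>w. F w * (e \<bullet> w))"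
  proof (rule Bochner_Integration.integrable_bound)
    show "integrable gauss (\<lambda>w::'a. (C * norm e) * norm w)"
      by (intro integrable_mult_right integrable_gauss_norm)
    show "AE w in gauss. norm (F w * (e \<bullet> w)) \<le> norm (C * norm e * norm w)"
    proof (rule AE_I2)
      fix w
      have "\<bar>F w\<bar> * \<bar>e \<bullet> w\<bar> \<le> C * (norm e * norm w)"
        by (intro mult_mono Fb Cauchy_Schwarz_ineq2 C) auto
      then show "norm (F w * (e \<bullet> w)) \<le> norm (C * norm e * norm w)"
        using C by (simp add: abs_mult mult.assoc)
    qed
  qed measurable
  have i1: "integrable lborel (\<lambda>w. gauss_density w * (s * (H w \<bullet> e)))"
    using integrable_mult_right[OF iH, of s] by (subst integrable_gauss_iff[symmetric]) auto
  have i2: "integrable lborel (\<lambda>w. gauss_density w * (F w * (e \<bullet> w)))"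
    using iFw by (subst integrable_gauss_iff[symmetric]) auto
  have good: "((\<lambda>w. gauss_density w * F w) has_derivative
      (\<lambda>h. gauss_density y * (s * (H y \<bullet> h)) - gauss_density y * (F y * (y \<bullet> h)))) (at y)"
    if "a + s *\<^sub>R y \<noteq> 0" for y
  proof -
    have "((\<lambda>w. a + s *\<^sub>R w) has_derivative (\<lambda>h. s *\<^sub>R h)) (at y)"
      by (auto intro!: derivative_eq_intros)
    from has_derivative_compose[OF this has_derivative_homog[OF f that]]
    have "(F has_derivative (\<lambda>h. s * (H y \<bullet> h))) (at y)"
      by (simp add: F_def[abs_def] H_def)
    from has_derivative_mult[OF has_derivative_gauss_density this]
    show ?thesis by (rule has_derivative_eq_rhs) (simp add: fun_eq_iff algebra_simps)
  qed
  have cont: "continuous_on {y. a + s *\<^sub>R y \<noteq> 0} D"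
  proof -
    have cH: "continuous_on {y. a + s *\<^sub>R y \<noteq> 0} H"
      unfolding H_def[abs_def]
      by (rule continuous_on_compose2[OF continuous_on_homog_grad[OF f]]) (auto intro!: continuous_intros)
    have cF: "continuous_on {y. a + s *\<^sub>R y \<noteq> 0} F"
      unfolding F_def[abs_def]
    proof (rule continuous_on_compose2[where t="- {0}" and g="\<lambda>y. f (direction y)" and f="\<lambda>w. a + s *\<^sub>R w"])
      show "continuous_on (- {0}) (\<lambda>y. f (direction y))"
        by (rule has_derivative_continuous_on) (auto intro!: has_derivative_at_withinI[OF has_derivative_homog[OF f]])
    qed (auto intro!: continuous_intros)
    have "continuous_on UNIV (gauss_density :: 'a \<Rightarrow> real)"
      by (rule has_derivative_continuous_on) (auto intro!: has_derivative_gauss_density)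
    then have cg: "continuous_on {y. a + s *\<^sub>R y \<noteq> 0} (gauss_density :: 'a \<Rightarrow> real)"
      by (rule continuous_on_subset) simp
    show ?thesis unfolding D_def[abs_def] by (intro continuous_intros cH cF cg)
  qed
  have "(\<integral>w. D w \<partial>lborel) = 0"
  proof (rule integral_directional_derivative_eq_0[OF iF])
    show "integrable lborel D" unfolding D_def[abs_def] by (intro Bochner_Integration.integrable_diff i1 i2)
    have "AE x in lborel. (1/s) *\<^sub>R a + x \<notin> span {e}" by (rule AE_lborel_not_line[OF dim])
    then show "AE x in lborel. (\<forall>t\<in>{0..1}. ((\<lambda>t. gauss_density (x + t *\<^sub>R e) * F (x + t *\<^sub>R e)) has_vector_derivative
        D (x + t *\<^sub>R e)) (at t within {0..1})) \<and> continuous_on {0..1} (\<lambda>t. D (x + t *\<^sub>R e))"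
    proof eventually_elim
      case (elim x)
      have nz: "a + s *\<^sub>R (x + t *\<^sub>R e) \<noteq> 0" for t
      proof
        assume "a + s *\<^sub>R (x + t *\<^sub>R e) = 0"
        then have "(1/s) *\<^sub>R (a + s *\<^sub>R (x + t *\<^sub>R e)) = 0" by simp
        then have "(1/s) *\<^sub>R a + x + t *\<^sub>R e = 0" using s by (simp add: scaleR_add_right add.assoc)
        then have "(1/s) *\<^sub>R a + x = (- t) *\<^sub>R e" by (simp add: eq_neg_iff_add_eq_0)
        with elim show False by (metis span_base span_mul singletonI)
      qed
      have "((\<lambda>t. gauss_density (x + t *\<^sub>R e) * F (x + t *\<^sub>R e)) has_vector_derivative
        D (x + t *\<^sub>R e)) (at t within {0..1})" for t
      proof -
        have "((\<lambda>t. x + t *\<^sub>R e) has_derivative (\<lambda>r. r *\<^sub>R e)) (at t within {0..1})"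
          by (auto intro!: derivative_eq_intros)
        from has_derivative_compose[OF this good[OF nz]] show ?thesis
          unfolding has_vector_derivative_def
          by (rule has_derivative_eq_rhs) (simp add: fun_eq_iff D_def algebra_simps inner_commute)
      qed
      moreover have "continuous_on {0..1} (\<lambda>t. D (x + t *\<^sub>R e))"
        by (rule continuous_on_compose2[OF cont]) (use nz in \<open>auto intro!: continuous_intros\<close>)
      ultimately show ?case by blast
    qed
  qed
  moreover have "(\<integral>w. D w \<partial>lborel) = (\<integral>w. s * (H w \<bullet> e) \<partial>gauss) - (\<integral>w. F w * (e \<bullet> w) \<partial>gauss)"
    unfolding D_def by (simp only: Bochner_Integration.integral_diff[OF i1 i2]) (subst (1 2) integral_gauss, auto)
  ultimately show ?thesis by (simp add: F_def H_def)
qed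

section \<open>Rotating one Gaussian vector into another\<close>

definition angle :: "real measure" where
  "angle = density lborel (indicator {0..pi/2})"

lemma sets_angle [simp, measurable_cong]: "sets angle = sets borel"
  by (simp add: angle_def)

lemma space_angle [simp]: "space angle = UNIV"
  by (simp add: angle_def)

lemma emeasure_angle: "emeasure angle UNIV = ennreal (pi / 2)"
  by (simp add: angle_def emeasure_density)

interpretation angle: finite_measure angle
  by standard (simp add: emeasure_angle)

lemma AE_angle: "AE \<theta> in angle. 0 < \<theta> \<and> \<theta> \<le> pi / 2"
proof -
  have "AE \<theta> in lborel. \<theta> \<noteq> (0::real)" by (rule AE_lborel_singleton)
  then show ?thesis
    unfolding angle_def by (subst AE_density) (auto simp: indicator_def elim!: eventually_mono split: if_splits)
qed

lemma integral_angle: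
  fixes f :: "real \<Rightarrow> real"
  assumes [measurable]: "f \<in> borel_measurable borel"
  shows "(\<integral>\<theta>. f \<theta> \<partial>angle) = (\<integral>\<theta>. indicator {0..pi/2} \<theta> * f \<theta> \<partial>lborel)"
proof -
  have "angle = density lborel (\<lambda>x. ennreal (indicator {0..pi/2} x))"
    unfolding angle_def by (rule arg_cong[where f="density lborel"]) (auto simp: fun_eq_iff indicator_def)
  then have "(\<integral>\<theta>. f \<theta> \<partial>angle) = (\<integral>\<theta>. f \<theta> \<partial>density lborel (\<lambda>x. ennreal (indicator {0..pi/2} x)))" by simp
  then show ?thesis by (subst (asm) integral_density) auto
qed

abbreviation gauss2 :: "('a::euclidean_space \<times> 'a) measure" where
  "gauss2 \<equiv> gauss \<Otimes>\<^sub>M gauss"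

text \<open>Geometrically a reflection rather than a rotation in the plane of the two components: this makes it an involution,
  so the same map both passes from \<open>(X, Z)\<close> to \<open>(Y, W)\<close> and back.\<close>

definition rot :: "real \<Rightarrow> 'a::euclidean_space \<times> 'a \<Rightarrow> 'a \<times> 'a" where
  "rot \<theta> p = (cos \<theta> *\<^sub>R fst p + sin \<theta> *\<^sub>R snd p, sin \<theta> *\<^sub>R fst p - cos \<theta> *\<^sub>R snd p)"

lemma orthogonal_transformation_rot: "orthogonal_transformation (rot \<theta>)"
  unfolding orthogonal_transformation
proof
  show "linear (rot \<theta> :: 'a \<times> 'a \<Rightarrow> _)"
    by (rule linearI) (auto simp: rot_def algebra_simps)
  have "(norm (rot \<theta> p))\<^sup>2 = (norm p)\<^sup>2" for p :: "'a \<times> 'a"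
  proof -
    have "(norm (rot \<theta> p))\<^sup>2 = rot \<theta> p \<bullet> rot \<theta> p" by (rule power2_norm_eq_inner)
    also have "\<dots> = ((cos \<theta>)\<^sup>2 + (sin \<theta>)\<^sup>2) * (fst p \<bullet> fst p) + ((cos \<theta>)\<^sup>2 + (sin \<theta>)\<^sup>2) * (snd p \<bullet> snd p)"
      unfolding rot_def inner_prod_def power2_eq_square
      by (simp add: inner_commute inner_simps algebra_simps del: sin_cos_squared_add3)
    also have "\<dots> = (norm p)\<^sup>2" by (simp add: power2_norm_eq_inner[of p] inner_prod_def)
    finally show ?thesis .
  qed
  then show "\<forall>p. norm (rot \<theta> p :: 'a \<times> 'a) = norm p" by (simp add: power2_eq_iff_nonneg)
qed

lemma rot_rot [simp]: "rot \<theta> (rot \<theta> p) = p"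
proof -
  have "(cos \<theta>)\<^sup>2 *\<^sub>R v + (sin \<theta>)\<^sup>2 *\<^sub>R v = v" for v :: 'a
    by (metis add.commute scaleR_left_distrib scaleR_one sin_cos_squared_add)
  then show ?thesis
    by (cases p) (simp add: rot_def algebra_simps power2_eq_square)
qed

lemma measurable_rot [measurable]: "(\<lambda>(\<theta>, p). rot \<theta> p) \<in> borel \<Otimes>\<^sub>M (borel \<Otimes>\<^sub>M borel) \<rightarrow>\<^sub>M borel \<Otimes>\<^sub>M borel"
  unfolding rot_def split_beta' by measurable

lemma measurable_rot' [measurable]: "rot \<theta> \<in> borel \<Otimes>\<^sub>M borel \<rightarrow>\<^sub>M borel \<Otimes>\<^sub>M borel"
  unfolding rot_def[abs_def] by measurable

lemma distr_gauss2_rot: "distr gauss2 gauss2 (rot \<theta>) = (gauss2 :: ('a::euclidean_space \<times> 'a) measure)"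
proof -
  have s: "sets (gauss2 :: ('a \<times> 'a) measure) = sets borel"
    unfolding borel_prod[symmetric] by (rule sets_pair_measure_cong) simp_all
  have "distr gauss2 gauss2 (rot \<theta>) = distr gauss2 borel (rot \<theta> :: 'a \<times> 'a \<Rightarrow> _)"
    by (rule distr_cong[OF refl s refl])
  then show ?thesis
    using distr_pair_gauss_orthogonal[OF orthogonal_transformation_rot] by simp
qed

lemma measurable_rot_gauss [measurable]: "rot \<theta> \<in> gauss2 \<rightarrow>\<^sub>M gauss2"
  using measurable_rot' by (simp cong: measurable_cong_sets sets_pair_measure_cong)

lemma nn_integral_gauss2_rot:
  assumes [measurable]: "f \<in> borel_measurable gauss2"
  shows "(\<integral>\<^sup>+p. f (rot \<theta> p) \<partial>gauss2) = (\<integral>\<^sup>+p. f p \<partial>gauss2)"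
  by (subst (2) distr_gauss2_rot[symmetric, of \<theta>], subst nn_integral_distr) auto

lemma integral_gauss2_rot:
  fixes f :: "'a::euclidean_space \<times> 'a \<Rightarrow> real"
  assumes [measurable]: "f \<in> borel_measurable gauss2"
  shows "(\<integral>p. f (rot \<theta> p) \<partial>gauss2) = (\<integral>p. f p \<partial>gauss2)"
  by (subst (2) distr_gauss2_rot[symmetric, of \<theta>], subst integral_distr) auto

text \<open>The path \<open>\<theta> \<mapsto> fst (rot \<theta> (x, z))\<close> leads from \<open>x\<close> to \<open>z\<close> with velocity \<open>- snd (rot \<theta> (x, z))\<close>.  It never meets
  the origin because \<open>x\<close> and \<open>z\<close> are linearly independent.\<close>

lemma rotation_FTC:
  assumes g: "C1_on_sphere (g :: 'a::euclidean_space \<Rightarrow> real)" and x: "x \<noteq> 0" and z: "z \<notin> span {x}"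
  shows "(\<integral>\<theta>. homog_grad g (fst (rot \<theta> (x, z))) \<bullet> snd (rot \<theta> (x, z)) \<partial>angle) = g (direction x) - g (direction z)"
proof -
  note [measurable] = homog_measurable[OF g]
  define Y where "Y \<theta> = cos \<theta> *\<^sub>R x + sin \<theta> *\<^sub>R z" for \<theta>
  define W where "W \<theta> = sin \<theta> *\<^sub>R x - cos \<theta> *\<^sub>R z" for \<theta>
  have nz: "Y \<theta> \<noteq> 0" for \<theta>
  proof
    assume 0: "Y \<theta> = 0"
    show False
    proof (cases "sin \<theta> = 0")
      case True
      then have "cos \<theta> \<noteq> 0" using sin_cos_squared_add[of \<theta>] by auto
      then show False using 0 x True by (simp add: Y_def)
    next
      case False
      from 0 have "sin \<theta> *\<^sub>R z = - (cos \<theta> *\<^sub>R x)" by (simp add: Y_def eq_neg_iff_add_eq_0 add.commute)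
      then have "(1 / sin \<theta>) *\<^sub>R (sin \<theta> *\<^sub>R z) = (1 / sin \<theta>) *\<^sub>R (- (cos \<theta> *\<^sub>R x))" by simp
      then have "z = (- cos \<theta> / sin \<theta>) *\<^sub>R x" using False by simp
      then show False using z by (metis span_base span_mul singletonI)
    qed
  qed
  have d: "((\<lambda>\<theta>. - g (direction (Y \<theta>))) has_vector_derivative homog_grad g (Y \<theta>) \<bullet> W \<theta>) (at \<theta> within {0..pi/2})" for \<theta>
  proof -
    have "(Y has_derivative (\<lambda>r. r *\<^sub>R (- W \<theta>))) (at \<theta> within {0..pi/2})"
      unfolding Y_def[abs_def] W_def by (auto intro!: derivative_eq_intros simp: algebra_simps)
    from has_derivative_minus[OF has_derivative_compose[OF this has_derivative_homog[OF g nz]]]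
    show ?thesis unfolding has_vector_derivative_def by simp
  qed
  have cY: "continuous_on A Y" and cW: "continuous_on A W" for A
    unfolding Y_def[abs_def] W_def[abs_def] by (intro continuous_intros)+
  have c: "continuous_on {0..pi/2} (\<lambda>\<theta>. homog_grad g (Y \<theta>) \<bullet> W \<theta>)"
    by (intro continuous_intros continuous_on_compose2[OF continuous_on_homog_grad[OF g] cY] cW) (use nz in auto)
  have [measurable]: "Y \<in> borel_measurable borel" "W \<in> borel_measurable borel"
    by (auto intro!: borel_measurable_continuous_onI cY cW)
  have "(\<integral>\<theta>. homog_grad g (Y \<theta>) \<bullet> W \<theta> \<partial>angle) = (\<integral>\<theta>. indicator {0..pi/2} \<theta> *\<^sub>R (homog_grad g (Y \<theta>) \<bullet> W \<theta>) \<partial>lborel)"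
    by (subst integral_angle) auto
  also have "\<dots> = - g (direction (Y (pi/2))) - (- g (direction (Y 0)))"
    by (rule integral_FTC_atLeastAtMost[OF _ d c]) simp
  finally show ?thesis by (simp add: rot_def Y_def W_def)
qed

section \<open>The covariance measure and the representation\<close>

lemma sigma_finite_gauss2: "sigma_finite_measure (gauss2 :: ('a::euclidean_space \<times> 'a) measure)"
  by (intro prob_space_imp_sigma_finite prob_spaceI gauss_pair.emeasure_space_1)

interpretation angle_gauss2: pair_sigma_finite angle "gauss2 :: ('a::euclidean_space \<times> 'a) measure"
  by (intro pair_sigma_finite.intro sigma_finite_gauss2 angle.sigma_finite_measure_axioms)

lemmas nn_integral_gauss2_snd = sigma_finite_measure.nn_integral_fst[OF sigma_finite_gauss2]

lemma measurable_gauss_eq: "measurable N gauss = borel_measurable N"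
  by (rule measurable_cong_sets) simp_all

lemma measurable_gauss2_components:
  assumes "g \<in> N \<rightarrow>\<^sub>M (gauss2 :: ('a::euclidean_space \<times> 'a) measure)"
  shows "(\<lambda>z. fst (g z)) \<in> borel_measurable N" "(\<lambda>z. snd (g z)) \<in> borel_measurable N"
  using measurable_compose[OF assms measurable_fst] measurable_compose[OF assms measurable_snd]
  by (simp_all add: measurable_gauss_eq)

lemma measurable_gauss2_Pair:
  assumes "f \<in> borel_measurable N" "g \<in> borel_measurable N"
  shows "(\<lambda>z. (f z, g z)) \<in> N \<rightarrow>\<^sub>M (gauss2 :: ('a::euclidean_space \<times> 'a) measure)"
  by (rule measurable_Pair) (use assms in \<open>simp_all add: measurable_gauss_eq\<close>)

lemma measurable_rot2 [measurable (raw)]: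
  assumes [measurable]: "f \<in> borel_measurable N" and g: "g \<in> N \<rightarrow>\<^sub>M gauss2"
  shows "(\<lambda>z. rot (f z) (g z)) \<in> N \<rightarrow>\<^sub>M (gauss2 :: ('a::euclidean_space \<times> 'a) measure)"
proof -
  note [measurable] = measurable_gauss2_components[OF g]
  show ?thesis unfolding rot_def by (rule measurable_gauss2_Pair) measurable
qed

text \<open>The factor \<open>sin \<theta>\<close> comes from the integration by parts and the two norms from \<open>homog_grad\<close>.  The absolute
  value changes nothing on \<open>{0..pi/2}\<close> and makes the weight nonnegative everywhere.\<close>

definition weight :: "real \<Rightarrow> 'a::euclidean_space \<times> 'a \<Rightarrow> real" where
  "weight \<theta> p = \<bar>sin \<theta>\<bar> / (norm (fst p) * norm (fst (rot \<theta> p)))"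

lemma weight_nonneg [simp]: "weight \<theta> p \<ge> 0"
  by (simp add: weight_def)

lemma measurable_weight [measurable (raw)]:
  assumes [measurable]: "f \<in> borel_measurable N" and g [measurable]: "g \<in> N \<rightarrow>\<^sub>M gauss2"
  shows "(\<lambda>z. weight (f z) (g z)) \<in> borel_measurable N"
proof -
  have "(\<lambda>z. rot (f z) (g z)) \<in> N \<rightarrow>\<^sub>M gauss2" by measurable
  note [measurable] = measurable_gauss2_components[OF g] measurable_gauss2_components[OF this]
  show ?thesis unfolding weight_def by measurable
qed

lemma nn_integral_inverse_norm_gauss_finite:
  assumes "DIM('a::euclidean_space) \<ge> 2"
  shows "(\<integral>\<^sup>+y. ennreal (1 / norm y) \<partial>(gauss :: 'a measure)) < \<infinity>"
proof -
  obtain K where K: "\<And>a s. s > 0 \<Longrightarrow> (\<integral>\<^sup>+w. ennreal (1 / norm (a + s *\<^sub>R w)) \<partial>(gauss :: 'a measure)) \<le> ennreal (K / s)"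
    using nn_integral_gauss_inverse_norm_bound[OF assms] by metis
  have "(\<integral>\<^sup>+y. ennreal (1 / norm y) \<partial>(gauss :: 'a measure)) \<le> ennreal K"
    using K[of 1 0] by simp
  then show ?thesis by (simp add: order_le_less_trans)
qed

text \<open>For fixed \<open>y\<close>, integrating \<open>1 / norm (cos \<theta> y + sin \<theta> w)\<close> over \<open>w\<close> costs a factor of order \<open>1 / sin \<theta>\<close>,
  which the numerator of the weight cancels; what remains is the integrable function \<open>1 / norm y\<close>.\<close>

lemma nn_integral_weight_finite:
  assumes "DIM('a::euclidean_space) \<ge> 2"
  shows "(\<integral>\<^sup>+z. ennreal (weight (fst z) (snd z)) \<partial>(angle \<Otimes>\<^sub>M (gauss2 :: ('a \<times> 'a) measure))) < \<infinity>"
proof -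
  obtain K where K0: "K \<ge> 0" and K: "\<And>a s. s > 0 \<Longrightarrow> (\<integral>\<^sup>+w. ennreal (1 / norm (a + s *\<^sub>R w)) \<partial>(gauss :: 'a measure)) \<le> ennreal (K / s)"
    using nn_integral_gauss_inverse_norm_bound[OF assms] by metis
  define J where "J = (\<integral>\<^sup>+y. ennreal (1 / norm y) \<partial>(gauss :: 'a measure))"
  have J: "J < \<infinity>" unfolding J_def by (rule nn_integral_inverse_norm_gauss_finite[OF assms])
  have inner: "(\<integral>\<^sup>+p. ennreal (weight \<theta> p) \<partial>(gauss2 :: ('a \<times> 'a) measure)) \<le> ennreal K * J"
    if "0 < \<theta>" "\<theta> \<le> pi / 2" for \<theta>
  proof -
    have s: "sin \<theta> > 0" using that by (intro sin_gt_zero) auto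
    have "(\<integral>\<^sup>+p. ennreal (weight \<theta> p) \<partial>(gauss2 :: ('a \<times> 'a) measure))
        = (\<integral>\<^sup>+y. \<integral>\<^sup>+w. ennreal (weight \<theta> (y, w)) \<partial>gauss \<partial>(gauss :: 'a measure))"
      by (subst gauss.nn_integral_fst[symmetric]) auto
    also have "\<dots> = (\<integral>\<^sup>+y. \<integral>\<^sup>+w. ennreal (sin \<theta> / norm y) * ennreal (1 / norm (cos \<theta> *\<^sub>R y + sin \<theta> *\<^sub>R w)) \<partial>gauss \<partial>(gauss :: 'a measure))"
      using s by (intro nn_integral_cong) (simp add: weight_def rot_def ennreal_mult[symmetric])
    also have "\<dots> = (\<integral>\<^sup>+y. ennreal (sin \<theta> / norm y) * (\<integral>\<^sup>+w. ennreal (1 / norm (cos \<theta> *\<^sub>R y + sin \<theta> *\<^sub>R w)) \<partial>gauss) \<partial>(gauss :: 'a measure))"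
      by (intro nn_integral_cong nn_integral_cmult) measurable
    also have "\<dots> \<le> (\<integral>\<^sup>+y. ennreal (sin \<theta> / norm y) * ennreal (K / sin \<theta>) \<partial>(gauss :: 'a measure))"
      by (intro nn_integral_mono mult_left_mono K s) auto
    also have "\<dots> = (\<integral>\<^sup>+y. ennreal K * ennreal (1 / norm y) \<partial>(gauss :: 'a measure))"
      using s K0 by (intro nn_integral_cong) (simp add: ennreal_mult[symmetric])
    also have "\<dots> = ennreal K * J" unfolding J_def by (rule nn_integral_cmult) measurable
    finally show ?thesis .
  qed
  have "(\<integral>\<^sup>+z. ennreal (weight (fst z) (snd z)) \<partial>(angle \<Otimes>\<^sub>M (gauss2 :: ('a \<times> 'a) measure)))
      = (\<integral>\<^sup>+\<theta>. \<integral>\<^sup>+p. ennreal (weight \<theta> p) \<partial>(gauss2 :: ('a \<times> 'a) measure) \<partial>angle)"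
    by (subst nn_integral_gauss2_snd[symmetric]) auto
  also have "\<dots> \<le> (\<integral>\<^sup>+\<theta>. ennreal K * J \<partial>angle)"
    by (rule nn_integral_mono_AE) (use AE_angle in \<open>eventually_elim; auto intro: inner\<close>)
  also have "\<dots> < \<infinity>" using J by (simp add: emeasure_angle ennreal_mult_less_top)
  finally show ?thesis .
qed

definition pair_dir :: "real \<Rightarrow> 'a::euclidean_space \<times> 'a \<Rightarrow> 'a \<times> 'a" where
  "pair_dir \<theta> p = (direction (fst (rot \<theta> p)), direction (fst p))"

lemma measurable_pair_dir [measurable (raw)]:
  assumes [measurable]: "f \<in> borel_measurable N" and g [measurable]: "g \<in> N \<rightarrow>\<^sub>M gauss2"
  shows "(\<lambda>z. pair_dir (f z) (g z)) \<in> N \<rightarrow>\<^sub>M sphere_unif \<Otimes>\<^sub>M sphere_unif"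
proof -
  have "(\<lambda>z. rot (f z) (g z)) \<in> N \<rightarrow>\<^sub>M gauss2" by measurable
  note [measurable] = measurable_gauss2_components[OF g] measurable_gauss2_components[OF this]
  show ?thesis unfolding pair_dir_def by measurable
qed

definition cov_measure :: "('a::euclidean_space \<times> 'a) measure" where
  "cov_measure = distr (density (angle \<Otimes>\<^sub>M gauss2) (\<lambda>z. ennreal (weight (fst z) (snd z))))
     (sphere_unif \<Otimes>\<^sub>M sphere_unif) (\<lambda>z. pair_dir (fst z) (snd z))"

lemma sets_cov_measure [simp, measurable_cong]: "sets cov_measure = sets (sphere_unif \<Otimes>\<^sub>M sphere_unif)"
  by (simp add: cov_measure_def)

lemma space_cov_measure: "space cov_measure = sphere 0 1 \<times> sphere 0 1"
  by (simp add: cov_measure_def space_pair_measure)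

lemma nn_integral_cov_measure:
  fixes h :: "'a::euclidean_space \<times> 'a \<Rightarrow> ennreal"
  assumes [measurable]: "h \<in> borel_measurable (sphere_unif \<Otimes>\<^sub>M sphere_unif)"
  shows "(\<integral>\<^sup>+q. h q \<partial>cov_measure) = (\<integral>\<^sup>+\<theta>. \<integral>\<^sup>+p. ennreal (weight \<theta> p) * h (pair_dir \<theta> p) \<partial>gauss2 \<partial>angle)"
proof -
  have "(\<integral>\<^sup>+q. h q \<partial>cov_measure) = (\<integral>\<^sup>+z. ennreal (weight (fst z) (snd z)) * h (pair_dir (fst z) (snd z)) \<partial>(angle \<Otimes>\<^sub>M gauss2))"
    unfolding cov_measure_def by (subst nn_integral_distr, measurable, subst nn_integral_density) auto
  then show ?thesis by (subst (asm) nn_integral_gauss2_snd[symmetric]) auto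
qed

lemma integral_cov_measure:
  fixes h :: "'a::euclidean_space \<times> 'a \<Rightarrow> real"
  assumes [measurable]: "h \<in> borel_measurable (sphere_unif \<Otimes>\<^sub>M sphere_unif)" and int: "integrable cov_measure h"
  shows "(\<integral>q. h q \<partial>cov_measure) = (\<integral>\<theta>. \<integral>p. weight \<theta> p * h (pair_dir \<theta> p) \<partial>gauss2 \<partial>angle)"
proof -
  have 1: "(\<integral>q. h q \<partial>cov_measure) = (\<integral>z. weight (fst z) (snd z) * h (pair_dir (fst z) (snd z)) \<partial>(angle \<Otimes>\<^sub>M gauss2))"
    unfolding cov_measure_def by (subst integral_distr, measurable, subst integral_density) auto
  have "integrable (angle \<Otimes>\<^sub>M gauss2) (\<lambda>z. weight (fst z) (snd z) * h (pair_dir (fst z) (snd z)))"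
    using int unfolding cov_measure_def
    by (subst (asm) integrable_distr_eq, measurable, subst (asm) integrable_density) auto
  from angle_gauss2.integral_fst'[OF this] 1 show ?thesis by simp
qed

lemma finite_measure_cov_measure:
  assumes "DIM('a::euclidean_space) \<ge> 2"
  shows "finite_measure (cov_measure :: ('a \<times> 'a) measure)"
proof
  have "emeasure (cov_measure :: ('a \<times> 'a) measure) (space cov_measure) = (\<integral>\<^sup>+q. 1 \<partial>(cov_measure :: ('a \<times> 'a) measure))"
    by simp
  also have "\<dots> = (\<integral>\<^sup>+\<theta>. \<integral>\<^sup>+p. ennreal (weight \<theta> p) \<partial>(gauss2 :: ('a \<times> 'a) measure) \<partial>angle)"
    by (subst nn_integral_cov_measure) auto
  also have "\<dots> = (\<integral>\<^sup>+z. ennreal (weight (fst z) (snd z)) \<partial>(angle \<Otimes>\<^sub>M (gauss2 :: ('a \<times> 'a) measure)))"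
    by (subst nn_integral_gauss2_snd[symmetric]) auto
  finally show "emeasure (cov_measure :: ('a \<times> 'a) measure) (space cov_measure) \<noteq> \<infinity>"
    using nn_integral_weight_finite[OF assms] by simp
qed

lemma integrable_cov_measure_grad:
  assumes dim: "DIM('a::euclidean_space) \<ge> 2" and f: "C1_on_sphere (f :: 'a \<Rightarrow> real)" and g: "C1_on_sphere g"
  shows "integrable cov_measure (\<lambda>q. sphere_grad f (fst q) \<bullet> sphere_grad g (snd q))"
proof -
  interpret finite_measure "cov_measure :: ('a \<times> 'a) measure" by (rule finite_measure_cov_measure[OF dim])
  note [measurable] = C1_on_sphere_measurable[OF f] C1_on_sphere_measurable[OF g]
  obtain A where A: "A \<ge> 0" "\<And>x. norm x = 1 \<Longrightarrow> norm (sphere_grad f x) \<le> A"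
    using C1_on_sphere_bounded[OF f] by metis
  obtain B where B: "B \<ge> 0" "\<And>x. norm x = 1 \<Longrightarrow> norm (sphere_grad g x) \<le> B"
    using C1_on_sphere_bounded[OF g] by metis
  show ?thesis
  proof (rule integrable_const_bound[where B="A * B"])
    show "AE q in cov_measure. norm (sphere_grad f (fst q) \<bullet> sphere_grad g (snd q)) \<le> A * B"
    proof (rule AE_I2)
      fix q :: "'a \<times> 'a" assume "q \<in> space cov_measure"
      then have "norm (fst q) = 1" "norm (snd q) = 1" by (auto simp: space_cov_measure)
      then have "norm (sphere_grad f (fst q)) * norm (sphere_grad g (snd q)) \<le> A * B"
        by (intro mult_mono A B) auto
      then show "norm (sphere_grad f (fst q) \<bullet> sphere_grad g (snd q)) \<le> A * B"
        using Cauchy_Schwarz_ineq2[of "sphere_grad f (fst q)" "sphere_grad g (snd q)"] by simp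
    qed
  qed measurable
qed

lemma integral_sphere_unif_gauss:
  fixes f :: "'a::euclidean_space \<Rightarrow> real"
  assumes [measurable]: "f \<in> borel_measurable sphere_unif"
  shows "(\<integral>x. f x \<partial>sphere_unif) = (\<integral>x. f (direction x) \<partial>gauss)"
  by (subst distr_gauss_direction[symmetric], subst integral_distr) auto

text \<open>Below, \<open>?A \<theta>\<close> is the integrand that the fundamental theorem of calculus produces and \<open>?B \<theta>\<close> is the same
  integrand after the change of variables \<open>rot \<theta>\<close>.  In the form \<open>?B\<close> the variable \<open>w\<close> occurs as a linear factor,
  ready for integration by parts.\<close>

theorem covariance_representation:
  assumes dim: "DIM('a::euclidean_space) \<ge> 2" and f: "C1_on_sphere (f :: 'a \<Rightarrow> real)" and g: "C1_on_sphere g"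
  shows "cov sphere_unif f g = (\<integral>q. sphere_grad f (fst q) \<bullet> sphere_grad g (snd q) \<partial>cov_measure)"
proof -
  note m [measurable] = homog_measurable[OF f] homog_measurable[OF g] C1_on_sphere_measurable[OF f] C1_on_sphere_measurable[OF g]
  obtain Cf where Cf: "Cf \<ge> 0" "\<And>x. norm x = 1 \<Longrightarrow> \<bar>f x\<bar> \<le> Cf"
    using C1_on_sphere_bounded[OF f] by metis
  obtain Cg where Cg: "Cg \<ge> 0" "\<And>x. norm x = 1 \<Longrightarrow> \<bar>g x\<bar> \<le> Cg" "\<And>x. norm x = 1 \<Longrightarrow> norm (sphere_grad g x) \<le> Cg"
    using C1_on_sphere_bounded[OF g] by metis
  define F G where "F x = f (direction x)" and "G x = g (direction x)" for x
  have [measurable]: "F \<in> borel_measurable borel" "G \<in> borel_measurable borel"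
    using m by (simp_all add: F_def[abs_def] G_def[abs_def])
  have iF: "integrable gauss F" and iG: "integrable gauss G" and iFG: "integrable gauss (\<lambda>x. F x * G x)"
  proof -
    show "integrable gauss F" by (rule gauss.integrable_const_bound[where B=Cf]) (auto simp: F_def Cf)
    show "integrable gauss G" by (rule gauss.integrable_const_bound[where B=Cg]) (auto simp: G_def Cg)
    show "integrable gauss (\<lambda>x. F x * G x)"
      by (rule gauss.integrable_const_bound[where B="Cf * Cg"]) (auto simp: F_def G_def abs_mult intro!: mult_mono Cf Cg)
  qed
  let ?A = "\<lambda>\<theta> p. F (fst p) * (homog_grad g (fst (rot \<theta> p)) \<bullet> snd (rot \<theta> p))"
  let ?B = "\<lambda>\<theta> p. F (fst (rot \<theta> p)) * (homog_grad g (fst p) \<bullet> snd p)"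
  \<comment> \<open>After the change of variables the integrand is at most a constant times \<open>norm w / norm y\<close>, uniformly in \<open>\<theta>\<close>.\<close>
  have intA: "integrable (angle \<Otimes>\<^sub>M gauss2) (\<lambda>(\<theta>, p). ?A \<theta> p)"
  proof (rule integrableI_bounded)
    let ?K = "ennreal (Cf * Cg) * ((\<integral>\<^sup>+y. ennreal (1 / norm y) \<partial>(gauss :: 'a measure)) * (\<integral>\<^sup>+w. ennreal (norm w) \<partial>(gauss :: 'a measure)))"
    have fin2: "(\<integral>\<^sup>+w. ennreal (norm w) \<partial>(gauss :: 'a measure)) < \<infinity>"
      using integrable_gauss_norm[where 'a='a] by (simp add: integrable_iff_bounded)
    have "(\<integral>\<^sup>+p. ennreal (norm (?A \<theta> p)) \<partial>gauss2) \<le> ?K" for \<theta>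
    proof -
      have "(\<integral>\<^sup>+p. ennreal (norm (?A \<theta> p)) \<partial>gauss2) = (\<integral>\<^sup>+p. ennreal (norm (?A \<theta> (rot \<theta> p))) \<partial>gauss2)"
        by (rule nn_integral_gauss2_rot[symmetric]) measurable
      also have "\<dots> \<le> (\<integral>\<^sup>+p. ennreal (Cf * Cg) * (ennreal (1 / norm (fst p)) * ennreal (norm (snd p))) \<partial>(gauss2 :: ('a \<times> 'a) measure))"
      proof (rule nn_integral_mono)
        fix p :: "'a \<times> 'a"
        have "\<bar>homog_grad g (fst p) \<bullet> snd p\<bar> \<le> norm (homog_grad g (fst p)) * norm (snd p)"
          by (rule Cauchy_Schwarz_ineq2)
        also have "\<dots> \<le> (Cg * (1 / norm (fst p))) * norm (snd p)"
          by (intro mult_right_mono homog_grad_bound Cg) auto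
        finally have "norm (?A \<theta> (rot \<theta> p)) \<le> Cf * (Cg * (1 / norm (fst p)) * norm (snd p))"
          by (simp only: rot_rot abs_mult real_norm_def) (intro mult_mono, auto simp: F_def Cf simp del: abs_mult)
        also have "\<dots> = (Cf * Cg) * ((1 / norm (fst p)) * norm (snd p))" by simp
        finally show "ennreal (norm (?A \<theta> (rot \<theta> p))) \<le> ennreal (Cf * Cg) * (ennreal (1 / norm (fst p)) * ennreal (norm (snd p)))"
          using Cf Cg by (simp only: ennreal_mult[symmetric] ennreal_leI mult_nonneg_nonneg zero_le_divide_1_iff norm_ge_zero)
      qed
      also have "\<dots> = ?K"
        by (simp add: nn_integral_cmult gauss.nn_integral_fst[symmetric] nn_integral_multc)
      finally show ?thesis .
    qed
    then have "(\<integral>\<^sup>+\<theta>. \<integral>\<^sup>+p. ennreal (norm (?A \<theta> p)) \<partial>gauss2 \<partial>angle) \<le> (\<integral>\<^sup>+\<theta>. ?K \<partial>angle)"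
      by (intro nn_integral_mono)
    also have "\<dots> < \<infinity>"
      using nn_integral_inverse_norm_gauss_finite[OF dim] fin2 by (simp add: emeasure_angle ennreal_mult_less_top)
    finally show "(\<integral>\<^sup>+z. ennreal (norm (case z of (\<theta>, p) \<Rightarrow> ?A \<theta> p)) \<partial>(angle \<Otimes>\<^sub>M gauss2)) < \<infinity>"
      by (subst nn_integral_gauss2_snd[symmetric]) auto
  qed measurable
  have FTC: "(\<integral>\<theta>. ?A \<theta> (x, z) \<partial>angle) = F x * (G x - G z)" if "x \<noteq> 0" "z \<notin> span {x}" for x z
    using rotation_FTC[OF g that] by (simp add: G_def)
  have ibp: "(\<integral>p. ?B \<theta> p \<partial>gauss2) = (\<integral>p. weight \<theta> p * (sphere_grad f (fst (pair_dir \<theta> p)) \<bullet> sphere_grad g (snd (pair_dir \<theta> p))) \<partial>gauss2)"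
    if \<theta>: "0 < \<theta>" "\<theta> \<le> pi / 2" and iB: "integrable gauss2 (?B \<theta>)"
      and iC: "integrable gauss2 (\<lambda>p. weight \<theta> p * (sphere_grad f (fst (pair_dir \<theta> p)) \<bullet> sphere_grad g (snd (pair_dir \<theta> p))))" for \<theta>
  proof -
    have s: "sin \<theta> > 0" using \<theta> by (intro sin_gt_zero) auto
    have "(\<integral>p. ?B \<theta> p \<partial>gauss2) = (\<integral>y. \<integral>w. ?B \<theta> (y, w) \<partial>gauss \<partial>gauss)"
      by (rule gauss_pair.integral_fst'[OF iB, symmetric])
    also have "\<dots> = (\<integral>y. \<integral>w. f (direction (cos \<theta> *\<^sub>R y + sin \<theta> *\<^sub>R w)) * (homog_grad g y \<bullet> w) \<partial>gauss \<partial>gauss)"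
      by (simp add: rot_def F_def)
    also have "\<dots> = (\<integral>y. sin \<theta> * (\<integral>w. homog_grad f (cos \<theta> *\<^sub>R y + sin \<theta> *\<^sub>R w) \<bullet> homog_grad g y \<partial>gauss) \<partial>gauss)"
      by (simp only: gauss_integration_by_parts[OF dim f s])
    also have "\<dots> = (\<integral>y. \<integral>w. weight \<theta> (y, w) * (sphere_grad f (fst (pair_dir \<theta> (y, w))) \<bullet> sphere_grad g (snd (pair_dir \<theta> (y, w)))) \<partial>gauss \<partial>gauss)"
      using s by (simp add: weight_def rot_def pair_dir_def homog_grad_def divide_inverse algebra_simps flip: integral_mult_right_zero)
    also have "\<dots> = (\<integral>p. weight \<theta> p * (sphere_grad f (fst (pair_dir \<theta> p)) \<bullet> sphere_grad g (snd (pair_dir \<theta> p))) \<partial>gauss2)"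
      by (rule gauss_pair.integral_fst'[OF iC])
    finally show ?thesis .
  qed
  have intC: "integrable (angle \<Otimes>\<^sub>M gauss2) (\<lambda>(\<theta>, p). weight \<theta> p * (sphere_grad f (fst (pair_dir \<theta> p)) \<bullet> sphere_grad g (snd (pair_dir \<theta> p))))"
    using integrable_cov_measure_grad[OF dim f g] unfolding cov_measure_def
    by (subst (asm) integrable_distr_eq, measurable, subst (asm) integrable_density) (auto simp: split_beta')
  have "cov sphere_unif f g = (\<integral>x. F x * G x \<partial>gauss) - (\<integral>x. F x \<partial>gauss) * (\<integral>z. G z \<partial>gauss)"
    unfolding cov_def by (simp add: integral_sphere_unif_gauss F_def G_def)
  also have "\<dots> = (\<integral>x. F x * G x - F x * (\<integral>z. G z \<partial>gauss) \<partial>gauss)"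
    by (subst Bochner_Integration.integral_diff) (use iF iFG in auto)
  also have "\<dots> = (\<integral>x. \<integral>z. F x * (G x - G z) \<partial>gauss \<partial>gauss)"
    using iG gauss.prob_space by (intro Bochner_Integration.integral_cong) (auto simp: algebra_simps)
  also have "\<dots> = (\<integral>x. \<integral>z. (\<integral>\<theta>. ?A \<theta> (x, z) \<partial>angle) \<partial>gauss \<partial>gauss)"
  proof (rule integral_cong_AE)
    have "AE x in gauss. x \<noteq> (0::'a)" by (intro AE_gauss AE_lborel_singleton)
    then show "AE x in gauss. (\<integral>z. F x * (G x - G z) \<partial>gauss) = (\<integral>z. (\<integral>\<theta>. ?A \<theta> (x, z) \<partial>angle) \<partial>gauss)"
    proof eventually_elim
      case (elim x)
      have "AE z in gauss. z \<notin> span {x}"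
        using AE_gauss[OF AE_lborel_not_line[OF dim, of 0]] by simp
      then have AE: "AE z in gauss. F x * (G x - G z) = (\<integral>\<theta>. ?A \<theta> (x, z) \<partial>angle)"
        by eventually_elim (rule FTC[OF elim, symmetric])
      show ?case
        by (rule integral_cong_AE[OF _ _ AE]) measurable
    qed
  qed measurable
  also have "\<dots> = (\<integral>p. (\<integral>\<theta>. ?A \<theta> p \<partial>angle) \<partial>gauss2)"
    by (rule gauss_pair.integral_fst'[OF angle_gauss2.integrable_snd[OF intA]])
  also have "\<dots> = (\<integral>\<theta>. (\<integral>p. ?A \<theta> p \<partial>gauss2) \<partial>angle)"
    by (rule angle_gauss2.Fubini_integral[OF intA])
  also have "\<dots> = (\<integral>\<theta>. (\<integral>p. weight \<theta> p * (sphere_grad f (fst (pair_dir \<theta> p)) \<bullet> sphere_grad g (snd (pair_dir \<theta> p))) \<partial>gauss2) \<partial>angle)"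
  proof (rule integral_cong_AE)
    show "AE \<theta> in angle. (\<integral>p. ?A \<theta> p \<partial>gauss2) = (\<integral>p. weight \<theta> p * (sphere_grad f (fst (pair_dir \<theta> p)) \<bullet> sphere_grad g (snd (pair_dir \<theta> p))) \<partial>gauss2)"
      using AE_angle angle_gauss2.AE_integrable_fst[OF intA] angle_gauss2.AE_integrable_fst[OF intC]
    proof eventually_elim
      case (elim \<theta>)
      have "integrable (distr gauss2 gauss2 (rot \<theta>)) (?A \<theta>)"
        using elim(2) by (simp add: distr_gauss2_rot)
      then have "integrable gauss2 (\<lambda>p. ?A \<theta> (rot \<theta> p))"
        by (subst (asm) integrable_distr_eq) auto
      then have iB: "integrable gauss2 (?B \<theta>)" by simp
      have "(\<integral>p. ?A \<theta> p \<partial>gauss2) = (\<integral>p. ?A \<theta> (rot \<theta> p) \<partial>gauss2)"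
        by (rule integral_gauss2_rot[symmetric]) measurable
      also have "\<dots> = (\<integral>p. ?B \<theta> p \<partial>gauss2)" by simp
      finally show ?case using ibp[OF _ _ iB elim(3)] elim(1) by simp
    qed
  qed measurable
  also have "\<dots> = (\<integral>q. sphere_grad f (fst q) \<bullet> sphere_grad g (snd q) \<partial>cov_measure)"
    by (rule integral_cov_measure[symmetric]) (measurable, rule integrable_cov_measure_grad[OF dim f g])
  finally show ?thesis .
qed

section \<open>Marginals\<close>

lemma weight_rot: "weight \<theta> (rot \<theta> p) = weight \<theta> p"
  by (simp add: weight_def mult.commute)

lemma pair_dir_rot: "pair_dir \<theta> (rot \<theta> p) = prod.swap (pair_dir \<theta> p)"
  by (simp add: pair_dir_def)

text \<open>\<open>rot \<theta>\<close> preserves the Gaussian pair and the weight and exchanges the two directions.\<close>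

lemma nn_integral_cov_measure_swap:
  fixes h :: "'a::euclidean_space \<times> 'a \<Rightarrow> ennreal"
  assumes [measurable]: "h \<in> borel_measurable (sphere_unif \<Otimes>\<^sub>M sphere_unif)"
  shows "(\<integral>\<^sup>+q. h (prod.swap q) \<partial>cov_measure) = (\<integral>\<^sup>+q. h q \<partial>cov_measure)"
proof -
  have "(\<integral>\<^sup>+q. h (prod.swap q) \<partial>cov_measure)
      = (\<integral>\<^sup>+\<theta>. \<integral>\<^sup>+p. ennreal (weight \<theta> (rot \<theta> p)) * h (pair_dir \<theta> (rot \<theta> p)) \<partial>gauss2 \<partial>angle)"
    unfolding weight_rot pair_dir_rot
    by (rule nn_integral_cov_measure[where h="\<lambda>q. h (prod.swap q)"]) (simp add: prod.swap_def, measurable)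
  also have "\<dots> = (\<integral>\<^sup>+\<theta>. \<integral>\<^sup>+p. ennreal (weight \<theta> p) * h (pair_dir \<theta> p) \<partial>gauss2 \<partial>angle)"
    by (intro nn_integral_cong nn_integral_gauss2_rot[where f="\<lambda>p. ennreal (weight _ p) * h (pair_dir _ p)"]) measurable
  also have "\<dots> = (\<integral>\<^sup>+q. h q \<partial>cov_measure)"
    by (rule nn_integral_cov_measure[symmetric]) measurable
  finally show ?thesis .
qed

text \<open>The reflection in the hyperplane orthogonal to \<open>y - y'\<close>.\<close>

lemma orthogonal_transformation_between:
  fixes y y' :: "'a::euclidean_space"
  assumes "norm y = norm y'"
  obtains T where "orthogonal_transformation T" "T y = y'"
proof (cases "y = y'")
  case True
  then show ?thesis using that[of "\<lambda>x. x"] orthogonal_transformation_id by auto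
next
  case False
  define u where "u = y - y'"
  define T where "T x = x - (2 * (x \<bullet> u) / (u \<bullet> u)) *\<^sub>R u" for x
  have u: "u \<bullet> u \<noteq> 0" using False by (simp add: u_def)
  have yy: "y \<bullet> y = y' \<bullet> y'" using assms by (simp add: norm_eq)
  have "orthogonal_transformation T"
    unfolding orthogonal_transformation_def
  proof (intro conjI allI)
    show "linear T" by (rule linearI) (auto simp: T_def algebra_simps inner_simps add_divide_distrib)
    show "T v \<bullet> T w = v \<bullet> w" for v w
      using u by (simp add: T_def inner_diff_left inner_diff_right inner_commute field_simps)
  qed
  moreover have "T y = y'"
  proof -
    have "2 * (y \<bullet> u) = u \<bullet> u"
      using yy by (simp add: u_def inner_diff_left inner_diff_right inner_commute)
    then show ?thesis using u by (simp add: T_def) (simp add: u_def)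
  qed
  ultimately show ?thesis by (rule that)
qed

text \<open>If \<open>T\<close> is orthogonal with \<open>T y = y'\<close>, then applying \<open>T\<close> to both components preserves the
  weight, and \<open>T w\<close> has the same law as \<open>w\<close>.\<close>

lemma nn_integral_weight_radial:
  fixes y y' :: "'a::euclidean_space"
  assumes "norm y = norm y'"
  shows "(\<integral>\<^sup>+w. ennreal (weight \<theta> (y, w)) \<partial>gauss) = (\<integral>\<^sup>+w. ennreal (weight \<theta> (y', w)) \<partial>gauss)"
proof -
  obtain T where T: "orthogonal_transformation T" "T y = y'"
    using orthogonal_transformation_between[OF assms] by metis
  have lin: "linear T" and n: "norm (T x) = norm x" for x
    using T(1) by (auto simp: orthogonal_transformation)
  have [measurable]: "T \<in> borel_measurable borel"
    using lin by (intro borel_measurable_continuous_onI linear_continuous_on) (simp add: linear_linear)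
  have eq: "weight \<theta> (T y, T w) = weight \<theta> (y, w)" for w
  proof -
    have "cos \<theta> *\<^sub>R T y + sin \<theta> *\<^sub>R T w = T (cos \<theta> *\<^sub>R y + sin \<theta> *\<^sub>R w)"
      by (simp add: linear_add[OF lin] linear_scale[OF lin])
    then show ?thesis by (simp add: weight_def rot_def n)
  qed
  have "(\<lambda>w. (y', w)) \<in> borel \<rightarrow>\<^sub>M gauss2" by (rule measurable_gauss2_Pair) auto
  then have [measurable]: "(\<lambda>w. weight \<theta> (y', w)) \<in> borel_measurable borel" by measurable
  have "(\<integral>\<^sup>+w. ennreal (weight \<theta> (y', w)) \<partial>gauss) = (\<integral>\<^sup>+w. ennreal (weight \<theta> (y', w)) \<partial>distr gauss borel T)"
    by (simp add: distr_gauss_orthogonal[OF T(1)])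
  also have "\<dots> = (\<integral>\<^sup>+w. ennreal (weight \<theta> (T y, T w)) \<partial>gauss)"
    by (subst nn_integral_distr) (auto simp: T)
  finally show ?thesis by (simp add: eq)
qed

text \<open>Integrating out \<open>w\<close> leaves a function of \<open>norm y\<close>, and the direction of \<open>y\<close> is independent of its norm.\<close>

lemma emeasure_cov_measure_snd:
  fixes A :: "'a::euclidean_space set"
  assumes A [measurable]: "A \<in> sets sphere_unif"
  shows "emeasure cov_measure (sphere 0 1 \<times> A) = emeasure sphere_unif A * emeasure (cov_measure :: ('a \<times> 'a) measure) (space cov_measure)"
proof -
  have *: "emeasure cov_measure (sphere 0 1 \<times> A)
     = emeasure sphere_unif A * (\<integral>\<^sup>+\<theta>. \<integral>\<^sup>+p. ennreal (weight \<theta> p) \<partial>(gauss2 :: ('a \<times> 'a) measure) \<partial>angle)"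
    if A [measurable]: "A \<in> sets sphere_unif" for A :: "'a set"
  proof -
    obtain e :: 'a where e: "norm e = 1" using norm_direction[of "0::'a"] by blast
    have inner: "(\<integral>\<^sup>+p. ennreal (weight \<theta> p) * indicator A (snd (pair_dir \<theta> p)) \<partial>gauss2)
        = emeasure sphere_unif A * (\<integral>\<^sup>+p. ennreal (weight \<theta> p) \<partial>(gauss2 :: ('a \<times> 'a) measure))" for \<theta>
    proof -
      \<comment> \<open>Any unit vector \<open>e\<close> serves to write the integral over \<open>w\<close> as a function of the norm of \<open>y\<close>.\<close>
      define q where "q r = (\<integral>\<^sup>+w. ennreal (weight \<theta> (r *\<^sub>R e, w)) \<partial>gauss)" for r
      have "(\<lambda>(r, w). (r *\<^sub>R e, w)) \<in> borel \<Otimes>\<^sub>M borel \<rightarrow>\<^sub>M gauss2"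
        unfolding split_beta' by (rule measurable_gauss2_Pair) measurable
      then have "(\<lambda>(r, w). weight \<theta> (r *\<^sub>R e, w)) \<in> borel_measurable (borel \<Otimes>\<^sub>M borel)"
        unfolding split_beta' by measurable
      then have "(\<lambda>(r, w). weight \<theta> (r *\<^sub>R e, w)) \<in> borel_measurable (borel \<Otimes>\<^sub>M gauss)"
        by (simp cong: measurable_cong_sets sets_pair_measure_cong)
      then have q [measurable]: "q \<in> borel_measurable borel"
        unfolding q_def[abs_def] by measurable
      have qn: "(\<integral>\<^sup>+w. ennreal (weight \<theta> (y, w)) \<partial>gauss) = q (norm y)" for y :: 'a
        unfolding q_def by (rule nn_integral_weight_radial) (simp add: e)
      have split: "(\<integral>\<^sup>+p. ennreal (weight \<theta> p) * indicator B (snd (pair_dir \<theta> p)) \<partial>gauss2)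
          = emeasure sphere_unif B * (\<integral>\<^sup>+y. q (norm y) \<partial>(gauss :: 'a measure))"
        if [measurable]: "B \<in> sets sphere_unif" for B :: "'a set"
      proof -
        have "(\<integral>\<^sup>+p. ennreal (weight \<theta> p) * indicator B (snd (pair_dir \<theta> p)) \<partial>gauss2)
          = (\<integral>\<^sup>+y. \<integral>\<^sup>+w. ennreal (weight \<theta> (y, w)) * indicator B (direction y) \<partial>gauss \<partial>gauss)"
          by (subst gauss.nn_integral_fst[symmetric]) (measurable, simp add: pair_dir_def)
        also have "\<dots> = (\<integral>\<^sup>+y. indicator B (direction y) * q (norm y) \<partial>gauss)"
          by (intro nn_integral_cong, subst nn_integral_multc) (auto simp: qn mult.commute)
        also have "\<dots> = (\<integral>\<^sup>+x. indicator B x \<partial>sphere_unif) * (\<integral>\<^sup>+y. q (norm y) \<partial>(gauss :: 'a measure))"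
          by (rule nn_integral_gauss_direction) measurable
        finally show ?thesis by simp
      qed
      have "(\<integral>\<^sup>+p. ennreal (weight \<theta> p) \<partial>(gauss2 :: ('a \<times> 'a) measure))
          = (\<integral>\<^sup>+p. ennreal (weight \<theta> p) * indicator (space sphere_unif) (snd (pair_dir \<theta> p)) \<partial>(gauss2 :: ('a \<times> 'a) measure))"
        by (rule nn_integral_cong) (simp add: pair_dir_def)
      also have "\<dots> = (\<integral>\<^sup>+y. q (norm y) \<partial>(gauss :: 'a measure))"
        using split[OF sets.top] prob_space.emeasure_space_1[OF prob_space_sphere_unif[where 'a='a]] by simp
      finally show ?thesis using split[OF A] by simp
    qed
    have "emeasure cov_measure (sphere 0 1 \<times> A) = (\<integral>\<^sup>+q. indicator (sphere 0 1 \<times> A) q \<partial>cov_measure)"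
      using A by (subst nn_integral_indicator) (auto intro: pair_measureI simp: space_sphere_unif[symmetric] simp del: space_sphere_unif)
    also have "\<dots> = (\<integral>\<^sup>+q. indicator A (snd q) \<partial>cov_measure)"
      by (rule nn_integral_cong) (auto simp: space_cov_measure indicator_def)
    also have "\<dots> = (\<integral>\<^sup>+\<theta>. emeasure sphere_unif A * (\<integral>\<^sup>+p. ennreal (weight \<theta> p) \<partial>(gauss2 :: ('a \<times> 'a) measure)) \<partial>angle)"
      by (subst nn_integral_cov_measure) (auto simp: inner)
    also have "\<dots> = emeasure sphere_unif A * (\<integral>\<^sup>+\<theta>. \<integral>\<^sup>+p. ennreal (weight \<theta> p) \<partial>(gauss2 :: ('a \<times> 'a) measure) \<partial>angle)"
      by (rule nn_integral_cmult) measurable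
    finally show ?thesis .
  qed
  have "emeasure (cov_measure :: ('a \<times> 'a) measure) (space cov_measure) = (\<integral>\<^sup>+\<theta>. \<integral>\<^sup>+p. ennreal (weight \<theta> p) \<partial>(gauss2 :: ('a \<times> 'a) measure) \<partial>angle)"
    using *[OF sets.top] prob_space.emeasure_space_1[OF prob_space_sphere_unif[where 'a='a]]
    by (simp add: space_cov_measure)
  with *[OF A] show ?thesis by simp
qed

lemma emeasure_cov_measure_fst:
  fixes A :: "'a::euclidean_space set"
  assumes A [measurable]: "A \<in> sets sphere_unif"
  shows "emeasure cov_measure (A \<times> sphere 0 1) = emeasure sphere_unif A * emeasure (cov_measure :: ('a \<times> 'a) measure) (space cov_measure)"
proof -
  have S: "sphere 0 1 \<in> sets (sphere_unif :: 'a measure)"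
    using sets.top[of "sphere_unif :: 'a measure"] by simp
  have "emeasure cov_measure (A \<times> sphere 0 1) = (\<integral>\<^sup>+q. indicator (A \<times> sphere 0 1) q \<partial>cov_measure)"
    using A S by (subst nn_integral_indicator) auto
  also have "\<dots> = (\<integral>\<^sup>+q. indicator (A \<times> sphere 0 1) (prod.swap q) \<partial>cov_measure)"
    by (rule nn_integral_cov_measure_swap[symmetric]) (use A S in auto)
  also have "\<dots> = (\<integral>\<^sup>+q. indicator (sphere 0 1 \<times> A) q \<partial>cov_measure)"
    by (rule nn_integral_cong) (auto simp: indicator_def)
  also have "\<dots> = emeasure cov_measure (sphere 0 1 \<times> A)"
    using A S by (subst nn_integral_indicator) auto
  finally show ?thesis by (simp add: emeasure_cov_measure_snd)
qed

section \<open>Bounds on the total mass\<close>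

lemma AE_cov_measureI:
  assumes [measurable]: "Measurable.pred (sphere_unif \<Otimes>\<^sub>M sphere_unif) P"
    and AE: "\<And>\<theta> y::'a::euclidean_space. 0 < \<theta> \<Longrightarrow> \<theta> \<le> pi / 2 \<Longrightarrow> y \<noteq> 0 \<Longrightarrow> AE w in gauss. P (pair_dir \<theta> (y, w))"
  shows "AE q in (cov_measure :: ('a \<times> 'a) measure). P q"
proof -
  let ?h = "\<lambda>q. if P q then 0 else (1::ennreal)"
  have "(\<integral>\<^sup>+q. ?h q \<partial>(cov_measure :: ('a \<times> 'a) measure))
     = (\<integral>\<^sup>+\<theta>. \<integral>\<^sup>+p. ennreal (weight \<theta> p) * ?h (pair_dir \<theta> p) \<partial>gauss2 \<partial>angle)"
    by (rule nn_integral_cov_measure) measurable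
  also have "\<dots> = (\<integral>\<^sup>+\<theta>. 0 \<partial>angle)"
  proof (rule nn_integral_cong_AE)
    show "AE \<theta> in angle. (\<integral>\<^sup>+p. ennreal (weight \<theta> p) * ?h (pair_dir \<theta> p) \<partial>gauss2) = 0"
      using AE_angle
    proof eventually_elim
      case (elim \<theta>)
      have "AE y in gauss. y \<noteq> (0::'a)" by (intro AE_gauss AE_lborel_singleton)
      then have AE0: "AE y in gauss. (\<integral>\<^sup>+w. ennreal (weight \<theta> (y, w)) * ?h (pair_dir \<theta> (y, w)) \<partial>gauss) = 0"
      proof eventually_elim
        case (elim y)
        have "AE w in gauss. ennreal (weight \<theta> (y, w)) * ?h (pair_dir \<theta> (y, w)) = 0"
          using AE[OF _ _ elim, of \<theta>] \<open>0 < \<theta> \<and> \<theta> \<le> pi / 2\<close> by (auto elim: eventually_mono)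
        then have "(\<integral>\<^sup>+w. ennreal (weight \<theta> (y, w)) * ?h (pair_dir \<theta> (y, w)) \<partial>gauss) = (\<integral>\<^sup>+w. 0 \<partial>(gauss :: 'a measure))"
          by (rule nn_integral_cong_AE)
        then show ?case by simp
      qed
      have "(\<integral>\<^sup>+p. ennreal (weight \<theta> p) * ?h (pair_dir \<theta> p) \<partial>gauss2)
        = (\<integral>\<^sup>+y. \<integral>\<^sup>+w. ennreal (weight \<theta> (y, w)) * ?h (pair_dir \<theta> (y, w)) \<partial>gauss \<partial>gauss)"
        by (subst gauss.nn_integral_fst[symmetric]) auto
      also have "\<dots> = (\<integral>\<^sup>+y. 0 \<partial>(gauss :: 'a measure))"
        by (rule nn_integral_cong_AE[OF AE0])
      finally show ?case by simp
    qed
  qed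
  finally have "(\<integral>\<^sup>+q. ?h q \<partial>(cov_measure :: ('a \<times> 'a) measure)) = 0" by simp
  then have "AE q in (cov_measure :: ('a \<times> 'a) measure). ?h q = 0"
    by (subst (asm) nn_integral_0_iff_AE) auto
  then show ?thesis by eventually_elim (auto split: if_splits)
qed

lemma measurable_cov_measure_inner [measurable]:
  "(\<lambda>q. fst q \<bullet> snd q) \<in> borel_measurable (cov_measure :: ('a::euclidean_space \<times> 'a) measure)"
proof -
  have [measurable]: "(\<lambda>x. x) \<in> borel_measurable (sphere_unif :: 'a measure)"
    by (simp cong: measurable_cong_sets add: sets_sphere_unif measurable_restrict_space1)
  have "fst \<in> (cov_measure :: ('a \<times> 'a) measure) \<rightarrow>\<^sub>M sphere_unif" "snd \<in> (cov_measure :: ('a \<times> 'a) measure) \<rightarrow>\<^sub>M sphere_unif"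
    by (simp_all cong: measurable_cong_sets)
  then have [measurable]: "fst \<in> borel_measurable (cov_measure :: ('a \<times> 'a) measure)" "snd \<in> borel_measurable (cov_measure :: ('a \<times> 'a) measure)"
    by (auto dest: measurable_compose[where g="\<lambda>x. x" and L=borel])
  show ?thesis by measurable
qed

text \<open>For fixed \<open>\<theta>\<close> and \<open>y \<noteq> 0\<close>, put \<open>x = cos \<theta> y + sin \<theta> w\<close>.  The directions of \<open>x\<close> and \<open>y\<close> are orthogonal
  only for \<open>w\<close> in a hyperplane, and parallel only for \<open>w\<close> on the line through \<open>y\<close>.\<close>

lemma AE_cov_measure_inner:
  assumes dim: "DIM('a::euclidean_space) \<ge> 2"
  shows "AE q in (cov_measure :: ('a \<times> 'a) measure). fst q \<bullet> snd q \<noteq> 0 \<and> \<bar>fst q \<bullet> snd q\<bar> \<noteq> 1"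
proof (rule AE_cov_measureI)
  fix \<theta> :: real and y :: 'a
  assume \<theta>: "0 < \<theta>" "\<theta> \<le> pi / 2" and y: "y \<noteq> 0"
  have s: "sin \<theta> > 0" using \<theta> by (intro sin_gt_zero) auto
  have "AE w in gauss. w \<notin> span {y}"
    using AE_gauss[OF AE_lborel_not_line[OF dim, of 0]] by simp
  moreover have "AE w in gauss. y \<bullet> w \<noteq> - (cos \<theta> * (y \<bullet> y)) / sin \<theta>"
    by (intro AE_gauss AE_lborel_not_hyperplane y)
  ultimately show "AE w in gauss. fst (pair_dir \<theta> (y, w)) \<bullet> snd (pair_dir \<theta> (y, w)) \<noteq> 0
      \<and> \<bar>fst (pair_dir \<theta> (y, w)) \<bullet> snd (pair_dir \<theta> (y, w))\<bar> \<noteq> 1"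
  proof eventually_elim
    case (elim w)
    define x where "x = cos \<theta> *\<^sub>R y + sin \<theta> *\<^sub>R w"
    have xs: "x \<notin> span {y}"
    proof
      assume "x \<in> span {y}"
      moreover have "cos \<theta> *\<^sub>R y \<in> span {y}" by (intro span_mul span_base) simp
      ultimately have "(1 / sin \<theta>) *\<^sub>R (x - cos \<theta> *\<^sub>R y) \<in> span {y}"
        by (rule span_mul[OF span_diff])
      then show False using elim s by (simp add: x_def)
    qed
    then have x: "x \<noteq> 0" by (auto simp: span_zero)
    have "y \<bullet> x = cos \<theta> * (y \<bullet> y) + sin \<theta> * (y \<bullet> w)"
      by (simp add: x_def inner_add_right)
    then have "y \<bullet> x \<noteq> 0" using elim(2) s by (auto simp: field_simps)
    then have 1: "direction x \<bullet> direction y \<noteq> 0"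
      using x y by (simp add: direction_eq_divideR inner_commute)
    have 2: "\<bar>direction x \<bullet> direction y\<bar> \<noteq> 1"
    proof
      assume "\<bar>direction x \<bullet> direction y\<bar> = 1"
      then have "\<bar>direction x \<bullet> direction y\<bar> = norm (direction x) * norm (direction y)" by simp
      then have "direction x = direction y \<or> direction x = - direction y"
        by (subst (asm) norm_cauchy_schwarz_abs_eq) auto
      moreover have "direction y \<in> span {y}"
        using span_mul[OF span_base[of y "{y}"], of "inverse (norm y)"] y by (simp add: direction_eq_divideR)
      ultimately have "direction x \<in> span {y}" by (auto intro: span_neg)
      then have "norm x *\<^sub>R direction x \<in> span {y}" by (rule span_mul)
      with xs show False by (simp add: direction_scaleR_norm)
    qed
    show ?case using 1 2 by (simp add: pair_dir_def rot_def x_def)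
  qed
qed measurable

lemma C1_on_sphere_inner: "C1_on_sphere (\<lambda>x. b \<bullet> x)"
  unfolding C1_on_sphere_def
  by (intro ballI exI[of _ UNIV] exI[of _ "\<lambda>x. b \<bullet> x"] exI[of _ "\<lambda>_. b"])
     (auto intro!: derivative_eq_intros)

lemma sphere_grad_inner: "norm x = 1 \<Longrightarrow> sphere_grad (\<lambda>x. b \<bullet> x) x = b - (b \<bullet> x) *\<^sub>R x"
  by (rule sphere_grad_eq_projection) (auto intro!: derivative_eq_intros)

text \<open>The integrand is odd and the Gaussian measure is invariant under \<open>x \<mapsto> - x\<close>.\<close>

lemma integral_sphere_unif_inner: "(\<integral>x. b \<bullet> x \<partial>sphere_unif) = 0"
  for b :: "'a::euclidean_space"
proof -
  note [measurable] = C1_on_sphere_measurable(1)[OF C1_on_sphere_inner[of b]]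
  let ?I = "\<integral>x. b \<bullet> direction x \<partial>gauss"
  have T: "orthogonal_transformation (\<lambda>x::'a. - x)" by (simp add: orthogonal_transformation_neg)
  have "?I = (\<integral>x. b \<bullet> direction x \<partial>distr gauss borel (\<lambda>x. - x))"
    by (simp add: distr_gauss_orthogonal[OF T])
  also have "\<dots> = (\<integral>x. b \<bullet> direction (- x) \<partial>gauss)"
    by (subst integral_distr) auto
  also have "\<dots> = (\<integral>x. - (b \<bullet> direction x) \<partial>gauss)"
  proof (rule integral_cong_AE)
    have "AE x in gauss. x \<noteq> (0::'a)" by (intro AE_gauss AE_lborel_singleton)
    then show "AE x in gauss. b \<bullet> direction (- x) = - (b \<bullet> direction x)"
      by eventually_elim (simp add: direction_eq_divideR)
  qed measurable
  finally have "?I = 0" by simp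
  then show ?thesis by (simp add: integral_sphere_unif_gauss)
qed

text \<open>The covariances of the coordinate functions sum to \<open>\<integral> (norm x)\<^sup>2 = 1\<close>, as the coordinates have mean zero.
  The inner products of their spherical gradients at \<open>x\<close> and \<open>y\<close> sum to the trace of the product of the two tangential
  projections, \<open>n - 2 + (x \<bullet> y)\<^sup>2\<close>.\<close>

lemma cov_measure_trace_identity:
  assumes dim: "DIM('a::euclidean_space) \<ge> 2"
  shows "1 = (real DIM('a) - 2) * measure cov_measure (space (cov_measure :: ('a \<times> 'a) measure))
     + (\<integral>q. (fst q \<bullet> snd q)\<^sup>2 \<partial>(cov_measure :: ('a \<times> 'a) measure))"
    and "integrable (cov_measure :: ('a \<times> 'a) measure) (\<lambda>q. (fst q \<bullet> snd q)\<^sup>2)"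
proof -
  let ?N = "cov_measure :: ('a \<times> 'a) measure"
  interpret N: finite_measure ?N by (rule finite_measure_cov_measure[OF dim])
  interpret S: prob_space "sphere_unif :: 'a measure" by (rule prob_space_sphere_unif)
  let ?f = "\<lambda>b x. b \<bullet> (x::'a)"
  show int: "integrable ?N (\<lambda>q. (fst q \<bullet> snd q)\<^sup>2)"
  proof (rule N.integrable_const_bound[where B=1])
    show "AE q in ?N. norm ((fst q \<bullet> snd q)\<^sup>2) \<le> 1"
    proof (rule AE_I2)
      fix q assume "q \<in> space ?N"
      then have "\<bar>fst q \<bullet> snd q\<bar> \<le> 1"
        using Cauchy_Schwarz_ineq2[of "fst q" "snd q"] by (auto simp: space_cov_measure)
      then show "norm ((fst q \<bullet> snd q)\<^sup>2) \<le> 1" by (simp add: abs_square_le_1)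
    qed
  qed measurable
  have "1 = (\<integral>x. (\<Sum>b\<in>Basis. ?f b x * ?f b x) \<partial>sphere_unif)"
  proof -
    have "(\<integral>x. (\<Sum>b\<in>Basis. ?f b x * ?f b x) \<partial>sphere_unif) = (\<integral>x. 1 \<partial>(sphere_unif :: 'a measure))"
      by (rule Bochner_Integration.integral_cong)
         (auto simp: inner_commute euclidean_inner[symmetric] norm_eq_1)
    then show ?thesis using S.prob_space by simp
  qed
  also have "\<dots> = (\<Sum>b\<in>Basis. cov sphere_unif (?f b) (?f b))"
  proof -
    have "integrable sphere_unif (\<lambda>x. ?f b x * ?f b x)" if "b \<in> Basis" for b
    proof (rule S.integrable_const_bound[where B="norm b * norm b"])
      show "AE x in sphere_unif. norm (?f b x * ?f b x) \<le> norm b * norm b"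
      proof (rule AE_I2)
        fix x :: 'a assume "x \<in> space sphere_unif"
        then have "\<bar>b \<bullet> x\<bar> \<le> norm b" using Cauchy_Schwarz_ineq2[of b x] by simp
        then show "norm (?f b x * ?f b x) \<le> norm b * norm b"
          unfolding norm_mult by (intro mult_mono) auto
      qed
    qed (use C1_on_sphere_measurable(1)[OF C1_on_sphere_inner[of b]] in measurable)
    then show ?thesis
      by (simp add: cov_def integral_sphere_unif_inner)
  qed
  also have "\<dots> = (\<Sum>b\<in>Basis. \<integral>q. sphere_grad (?f b) (fst q) \<bullet> sphere_grad (?f b) (snd q) \<partial>?N)"
    by (simp add: covariance_representation[OF dim C1_on_sphere_inner C1_on_sphere_inner])
  also have "\<dots> = (\<integral>q. (\<Sum>b\<in>Basis. sphere_grad (?f b) (fst q) \<bullet> sphere_grad (?f b) (snd q)) \<partial>?N)"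
    by (rule Bochner_Integration.integral_sum[symmetric])
       (rule integrable_cov_measure_grad[OF dim C1_on_sphere_inner C1_on_sphere_inner])
  also have "\<dots> = (\<integral>q. (real DIM('a) - 2) + (fst q \<bullet> snd q)\<^sup>2 \<partial>?N)"
  proof (rule Bochner_Integration.integral_cong[OF refl])
    fix q assume "q \<in> space ?N"
    then have n: "norm (fst q) = 1" "norm (snd q) = 1" by (auto simp: space_cov_measure)
    obtain x y where q: "q = (x, y)" by (cases q)
    have n': "norm x = 1" "norm y = 1" "x \<bullet> x = 1" "y \<bullet> y = 1" using n by (auto simp: q norm_eq_1)
    have "(b - (b \<bullet> x) *\<^sub>R x) \<bullet> (b - (b \<bullet> y) *\<^sub>R y)
       = 1 - (x \<bullet> b) * (x \<bullet> b) - (y \<bullet> b) * (y \<bullet> b) + (x \<bullet> y) * ((x \<bullet> b) * (y \<bullet> b))" if "b \<in> Basis" for b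
      using that by (simp add: inner_diff_left inner_diff_right inner_commute algebra_simps)
    then have "(\<Sum>b\<in>Basis. sphere_grad (?f b) x \<bullet> sphere_grad (?f b) y)
       = (\<Sum>b\<in>Basis. 1 - (x \<bullet> b) * (x \<bullet> b) - (y \<bullet> b) * (y \<bullet> b) + (x \<bullet> y) * ((x \<bullet> b) * (y \<bullet> b)))"
      using n' by (simp add: sphere_grad_inner)
    also have "\<dots> = real DIM('a) - x \<bullet> x - y \<bullet> y + (x \<bullet> y) * (x \<bullet> y)"
      by (simp only: sum.distrib sum_subtractf sum_distrib_left[symmetric] euclidean_inner[symmetric] sum_constant mult_1_right)
    finally show "(\<Sum>b\<in>Basis. sphere_grad (?f b) (fst q) \<bullet> sphere_grad (?f b) (snd q)) = (real DIM('a) - 2) + (fst q \<bullet> snd q)\<^sup>2"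
      using n' by (simp add: q power2_eq_square)
  qed
  also have "\<dots> = (real DIM('a) - 2) * measure ?N (space ?N) + (\<integral>q. (fst q \<bullet> snd q)\<^sup>2 \<partial>?N)"
    by (subst Bochner_Integration.integral_add[OF _ int]) auto
  finally show "1 = (real DIM('a) - 2) * measure ?N (space ?N) + (\<integral>q. (fst q \<bullet> snd q)\<^sup>2 \<partial>?N)" .
qed

text \<open>Write the trace identity as \<open>1 = (n - 2) c + I\<close> with \<open>I = \<integral> (x \<bullet> y)\<^sup>2\<close>.  Then \<open>I > 0\<close> is
  the upper bound on \<open>c\<close> if \<open>n \<ge> 3\<close>, and \<open>I < c\<close> the lower one.\<close>

lemma cov_measure_mass_bounds:
  assumes dim: "DIM('a::euclidean_space) \<ge> 2"
  defines "c \<equiv> measure cov_measure (space (cov_measure :: ('a \<times> 'a) measure))"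
  shows "c > 0" and "DIM('a) \<ge> 3 \<Longrightarrow> 1 / (real DIM('a) - 1) < c" and "DIM('a) \<ge> 3 \<Longrightarrow> c < 1 / (real DIM('a) - 2)"
proof -
  let ?N = "cov_measure :: ('a \<times> 'a) measure"
  interpret N: finite_measure ?N by (rule finite_measure_cov_measure[OF dim])
  define I where "I = (\<integral>q. (fst q \<bullet> snd q)\<^sup>2 \<partial>?N)"
  have id: "1 = (real DIM('a) - 2) * c + I"
    using cov_measure_trace_identity(1)[OF dim] by (simp add: I_def c_def)
  note int = cov_measure_trace_identity(2)[OF dim]
  note AEi = AE_cov_measure_inner[OF dim]
  \<comment> \<open>If the measure were zero, then so would be both terms of the trace identity.\<close>
  have not_trivial: "\<not> (AE q in ?N. False)"
  proof
    assume F: "AE q in ?N. False"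
    then have "emeasure ?N (space ?N) = 0" by (simp add: AE_iff_measurable[OF sets.top])
    then have "c = 0" by (simp add: c_def measure_def)
    moreover have "I = (\<integral>q. 0 \<partial>?N)" unfolding I_def
      by (rule integral_cong_AE) (measurable, use F in \<open>auto elim: eventually_mono\<close>)
    ultimately show False using id by simp
  qed
  have Ipos: "I > 0"
  proof -
    have "I \<noteq> 0"
    proof
      assume "I = 0"
      then have "AE q in ?N. (fst q \<bullet> snd q)\<^sup>2 = 0"
        using integral_nonneg_eq_0_iff_AE[OF int] by (simp add: I_def)
      then have "AE q in ?N. False" using AEi by eventually_elim simp
      with not_trivial show False ..
    qed
    moreover have "I \<ge> 0" unfolding I_def by simp
    ultimately show ?thesis by simp
  qed
  have le1: "(fst q \<bullet> snd q)\<^sup>2 \<le> 1" if "q \<in> space ?N" for q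
    using that Cauchy_Schwarz_ineq2[of "fst q" "snd q"] by (auto simp: space_cov_measure abs_square_le_1)
  have int1: "integrable ?N (\<lambda>q. 1 - (fst q \<bullet> snd q)\<^sup>2)" by (intro Bochner_Integration.integrable_diff int) simp
  have diff: "(\<integral>q. 1 - (fst q \<bullet> snd q)\<^sup>2 \<partial>?N) = c - I"
    unfolding I_def c_def by (subst Bochner_Integration.integral_diff[OF _ int]) auto
  have Ic: "I < c"
  proof -
    have nn: "AE q in ?N. 0 \<le> 1 - (fst q \<bullet> snd q)\<^sup>2" by (rule AE_I2) (simp add: le1)
    have "c - I \<noteq> 0"
    proof
      assume "c - I = 0"
      then have "AE q in ?N. 1 - (fst q \<bullet> snd q)\<^sup>2 = 0"
        using integral_nonneg_eq_0_iff_AE[OF int1 nn] diff by simp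
      then have "AE q in ?N. False" using AEi by eventually_elim (auto simp: power2_eq_1_iff)
      with not_trivial show False ..
    qed
    moreover have "c - I \<ge> 0" unfolding diff[symmetric] by (rule integral_nonneg_AE[OF nn])
    ultimately show ?thesis by simp
  qed
  show "c > 0" using Ipos Ic by simp
  assume "DIM('a) \<ge> 3"
  then have n: "real DIM('a) \<ge> 3" by simp
  show "1 / (real DIM('a) - 1) < c" "c < 1 / (real DIM('a) - 2)"
    using id Ipos Ic n by (auto simp: field_simps)
qed

theorem sphere_covariance_measure:
  assumes dim: "DIM('a::euclidean_space) \<ge> 2"
  shows "\<exists>\<nu> :: ('a \<times> 'a) measure.
    sets \<nu> = sets (sphere_unif \<Otimes>\<^sub>M sphere_unif) \<and>
    (\<forall>f g. C1_on_sphere f \<longrightarrow> C1_on_sphere g \<longrightarrow>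
       integrable \<nu> (\<lambda>(x, y). sphere_grad f x \<bullet> sphere_grad g y) \<and>
       cov sphere_unif f g = (\<integral>(x, y). sphere_grad f x \<bullet> sphere_grad g y \<partial>\<nu>)) \<and>
    (\<exists>\<mu> c. prob_space \<mu> \<and> sets \<mu> = sets (sphere_unif \<Otimes>\<^sub>M sphere_unif) \<and>
       distr \<mu> sphere_unif fst = sphere_unif \<and> distr \<mu> sphere_unif snd = sphere_unif \<and>
       c > 0 \<and> \<nu> = scale_measure (ennreal c) \<mu> \<and>
       (DIM('a) \<ge> 3 \<longrightarrow>
          1 / (real DIM('a) - 1) < c \<and> c < 1 / (real DIM('a) - 2)))"
proof -
  let ?N = "cov_measure :: ('a \<times> 'a) measure"
  interpret N: finite_measure ?N by (rule finite_measure_cov_measure[OF dim])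
  define c where "c = measure ?N (space ?N)"
  have c: "c > 0" and bounds: "DIM('a) \<ge> 3 \<Longrightarrow> 1 / (real DIM('a) - 1) < c \<and> c < 1 / (real DIM('a) - 2)"
    using cov_measure_mass_bounds[OF dim] by (auto simp: c_def)
  have mass: "emeasure ?N (space ?N) = ennreal c" by (simp add: c_def N.emeasure_eq_measure)
  have cc: "ennreal (1 / c) * ennreal c = 1" using c by (simp add: ennreal_mult[symmetric])
  define \<mu> where "\<mu> = scale_measure (ennreal (1 / c)) ?N"
  have sets: "sets \<mu> = sets (sphere_unif \<Otimes>\<^sub>M sphere_unif)" by (simp add: \<mu>_def)
  then have space: "space \<mu> = sphere 0 1 \<times> sphere 0 1"
    using sets_eq_imp_space_eq[OF sets] by (simp add: space_pair_measure)
  note [measurable_cong] = sets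
  have "prob_space \<mu>"
    by (rule prob_spaceI) (simp add: \<mu>_def space_scale_measure mass cc)
  moreover have "distr \<mu> sphere_unif fst = sphere_unif"
  proof (rule measure_eqI)
    fix A assume "A \<in> sets (distr \<mu> sphere_unif (fst :: 'a \<times> 'a \<Rightarrow> 'a))"
    then have A: "A \<in> sets sphere_unif" by simp
    then have "A \<subseteq> sphere 0 1" using sets.sets_into_space by fastforce
    then have "fst -` A \<inter> space \<mu> = A \<times> sphere 0 1" by (auto simp: space)
    then show "emeasure (distr \<mu> sphere_unif fst) A = emeasure sphere_unif A"
      using A by (subst emeasure_distr) (auto simp: \<mu>_def emeasure_cov_measure_fst mass mult.left_commute cc)
  qed simp
  moreover have "distr \<mu> sphere_unif snd = sphere_unif"
  proof (rule measure_eqI)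
    fix A assume "A \<in> sets (distr \<mu> sphere_unif (snd :: 'a \<times> 'a \<Rightarrow> 'a))"
    then have A: "A \<in> sets sphere_unif" by simp
    then have "A \<subseteq> sphere 0 1" using sets.sets_into_space by fastforce
    then have "snd -` A \<inter> space \<mu> = sphere 0 1 \<times> A" by (auto simp: space)
    then show "emeasure (distr \<mu> sphere_unif snd) A = emeasure sphere_unif A"
      using A by (subst emeasure_distr) (auto simp: \<mu>_def emeasure_cov_measure_snd mass mult.left_commute cc)
  qed simp
  moreover have "?N = scale_measure (ennreal c) \<mu>"
    by (rule measure_eqI) (auto simp: \<mu>_def mult.assoc[symmetric] mult.commute[of "ennreal c"] cc)
  ultimately have "\<exists>\<mu> c. prob_space \<mu> \<and> sets \<mu> = sets (sphere_unif \<Otimes>\<^sub>M sphere_unif) \<and>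
       distr \<mu> sphere_unif fst = sphere_unif \<and> distr \<mu> sphere_unif snd = sphere_unif \<and>
       c > 0 \<and> ?N = scale_measure (ennreal c) \<mu> \<and>
       (DIM('a) \<ge> 3 \<longrightarrow> 1 / (real DIM('a) - 1) < c \<and> c < 1 / (real DIM('a) - 2))"
    using sets c bounds by blast
  then show ?thesis
    using integrable_cov_measure_grad[OF dim] covariance_representation[OF dim]
    by (intro exI[of _ ?N]) (auto simp: split_beta')
qed

text \<open>The coordinate space \<open>real ^ 'n\<close> is the case \<open>DIM('a) = CARD('n)\<close>.\<close>

theorem theorem1p1:
  assumes "CARD('n::finite) \<ge> 2"
  shows "\<exists>\<nu> :: ((real^'n) \<times> (real^'n)) measure.
    sets \<nu> = sets (sphere_unif \<Otimes>\<^sub>M sphere_unif) \<and>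
    (\<forall>f g. C1_on_sphere f \<longrightarrow> C1_on_sphere g \<longrightarrow>
       integrable \<nu> (\<lambda>(x, y). sphere_grad f x \<bullet> sphere_grad g y) \<and>
       cov sphere_unif f g = (\<integral>(x, y). sphere_grad f x \<bullet> sphere_grad g y \<partial>\<nu>)) \<and>
    (\<exists>\<mu> c. prob_space \<mu> \<and> sets \<mu> = sets (sphere_unif \<Otimes>\<^sub>M sphere_unif) \<and>
       distr \<mu> sphere_unif fst = sphere_unif \<and> distr \<mu> sphere_unif snd = sphere_unif \<and>
       c > 0 \<and> \<nu> = scale_measure (ennreal c) \<mu> \<and>
       (CARD('n) \<ge> 3 \<longrightarrow>
          1 / (real CARD('n) - 1) < c \<and> c < 1 / (real CARD('n) - 2)))"
  using sphere_covariance_measure[where 'a="real^'n"] assms by simp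

end
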